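(* Let $\hat k$ be a quadratic extension of $k$, let $\mathcal{O}(\hat k)=\{P\in S^3((k^2)^* ): \hat k\text{ is a splitting field of the polynomial } X^2-Q_n(P) \text{ over } k\}$, and let $I_{\widehat{\mathcal{O}}_{[1]}}:\mathcal{O}(\hat k)\to \mathrm{Im}\,\hat k^*\times_{Z_2}U(\hat k^*/\hat k^{*3})$ be the map $$I_{\widehat{\mathcal{O}}_{[1]}}(P)=[\hat\omega(\lambda\alpha^3,\bar\lambda\bar\alpha^3),\,[\lambda\bar\lambda^{-1}]],$$ where $P=\lambda\alpha^3+\bar\lambda\bar\alpha^3$ with $\lambda\in\hat k^*$, $\alpha\in(\hat k^2)^*$. (i) Let $P,P'\in\mathcal{O}(\hat k)$. Then $\mathrm{Sl}(2,k)\cdot P'=\mathrm{Sl}(2,k)\cdot P$ if and only if $I_{\widehat{\mathcal{O}}_{[1]}}(P')=I_{\widehat{\mathcal{O}}_{[1]}}(P)$. (ii) The map $I_{\widehat{\mathcal{O}}_{[1]}}$ induces a bijection from $\mathcal{O}(\hat k)/\mathrm{Sl}(2,k)$ onto $\mathrm{Im}\,\hat k^*\times_{Z_2}U(\hat k^*/\hat k^{*3})$. (iii) The isotropy group in $\mathrm{Sl}(2,k)$ of $P\in\mathcal{O}(\hat k)$ is isomorphic to $$\left\{\begin{pmatrix}\lambda&0\\0&\bar\lambda\end{pmatrix}\in\mathrm{Sl}(2,\hat k):\ \lambda^3=1,\ \lambda\bar\lambda=1\right\}.$$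
   Context: $k$ is a field of characteristic different from $2$ and $3$; $x,y$ is the standard coordinate basis of $(k^2)^*$; $S^3((k^2)^* )=\{ax^3+3bx^2y+3cxy^2+dy^3: a,b,c,d\in k\}$ is the space of binary cubics. $\mathrm{Sl}(2,k)$ acts on $(k^2)^*$ by transpose inverse, $(g\cdot\phi)(v)=\phi(g^{-1}v)$, and functorially on $S^3((k^2)^* )$. The symplectic form is $\omega(P,P')=ad'-da'-3bc'+3cb'$ for $P=ax^3+3bx^2y+3cxy^2+dy^3$, $P'=a'x^3+3b'x^2y+3c'xy^2+d'y^3$, and $Q_n(P)=a^2d^2-3b^2c^2-6abcd+4b^3d+4ac^3$. For the quadratic extension $\hat k/k$ (Galois since $\mathrm{char}\,k\ne2$), $z\mapsto\bar z$ denotes the action of the generator of $\mathrm{Gal}(\hat k/k)\cong Z_2$ on $\hat k$ and on any space obtained by base extension from $k$ (the fixed points being the original $k$-space); $\hat\omega$ is the base extension of $\omega$ to $S^3((\hat k^2)^* )$. $\mathrm{Im}\,\hat k=\{\lambda\in\hat k:\bar\lambda=-\lambda\}$ and $\mathrm{Im}\,\hat k^*$ is its set of nonzero elements. $U(\hat k^*/\hat k^{*3})=\{\alpha\in\hat k^*/\hat k^{*3}:\alpha\bar\alpha=1\}$. $\mathrm{Im}\,\hat k^*\times_{Z_2}U(\hat k^*/\hat k^{*3})$ is the quotient of $\mathrm{Im}\,\hat k^*\times U(\hat k^*/\hat k^{*3})$ by the $Z_2$-action $-1\cdot(\xi,\alpha)=(-\xi,\alpha^{-1})$, which is the natural action of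 $\mathrm{Gal}(\hat k/k)$; the class of $(\xi,\alpha)$ is $[\xi,\alpha]$. Every $P\in\mathcal{O}(\hat k)$ can be written $P=\lambda\alpha^3+\bar\lambda\bar\alpha^3$ with $\lambda\in\hat k^*$, $\alpha\in(\hat k^2)^*$ and $\alpha,\bar\alpha$ linearly independent; the unordered pair of summands is unique, and $Q_n(P)=\hat\omega(\lambda\alpha^3,\bar\lambda\bar\alpha^3)^2$. Hence $I_{\widehat{\mathcal{O}}_{[1]}}$ is well defined. *)

theory Defs
  imports
    "HOL-Analysis.Determinants"
    "HOL-Algebra.Group_Action"
    "HOL-Computational_Algebra.Polynomial"
begin

section \<open>Quadratic extensions\<close>

definition field_hom :: "('a::field \<Rightarrow> 'b::field) \<Rightarrow> bool" where
  "field_hom \<iota> \<longleftrightarrow> \<iota> 1 = 1 \<and> (\<forall>a b. \<iota> (a + b) = \<iota> a + \<iota> b) \<and> (\<forall>a b. \<iota> (a * b) = \<iota> a * \<iota> b)"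

text \<open>
  A field extension is an embedding \<open>\<iota>\<close> of fields. The larger field is a vector space
  over the smaller one by \<open>a \<cdot> z = \<iota> a * z\<close>.
\<close>

definition quadratic_extension :: "('k::field \<Rightarrow> 'K::field) \<Rightarrow> bool" where
  "quadratic_extension \<iota> \<longleftrightarrow>
     field_hom \<iota> \<and> vector_space.dim (\<lambda>a z. \<iota> a * z) (UNIV :: 'K set) = 2"

definition Gal :: "('k::field \<Rightarrow> 'K::field) \<Rightarrow> ('K \<Rightarrow> 'K) set" where
  "Gal \<iota> = {\<sigma>. field_hom \<sigma> \<and> bij \<sigma> \<and> (\<forall>a. \<sigma> (\<iota> a) = \<iota> a)}"

text \<open>
  For a quadratic extension in characteristic not two, the Galois group has order two and
  its generator is its only element different from the identity.
\<close>

definition gal_conj :: "('k::field \<Rightarrow> 'K::field) \<Rightarrow> 'K \<Rightarrow> 'K" where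
  "gal_conj \<iota> = (THE \<sigma>. \<sigma> \<in> Gal \<iota> \<and> \<sigma> \<noteq> id)"

definition subfield_set :: "'a::field set \<Rightarrow> bool" where
  "subfield_set F \<longleftrightarrow> 1 \<in> F \<and> (\<forall>a\<in>F. \<forall>b\<in>F. a - b \<in> F \<and> a * b \<in> F) \<and> (\<forall>a\<in>F. inverse a \<in> F)"

text \<open>The polynomial splits into linear factors, and its roots generate the extension.\<close>

definition splitting_field :: "('k::field \<Rightarrow> 'K::field) \<Rightarrow> 'k poly \<Rightarrow> bool" where
  "splitting_field \<iota> p \<longleftrightarrow>
     (\<exists>c rs. map_poly \<iota> p = smult c (\<Prod>r\<leftarrow>rs. [:- r, 1:])) \<and>
     (\<forall>F. subfield_set F \<and> range \<iota> \<union> {r. poly (map_poly \<iota> p) r = 0} \<subseteq> F \<longrightarrow> F = UNIV)"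


section \<open>Binary cubics and the action of the special linear group\<close>

text \<open>
  The symmetric algebra of the dual of \<open>k\<^sup>2\<close> is \<open>k[x][y]\<close>, a nested univariate
  polynomial ring: the inner variable is \<open>x\<close>, the outer one is \<open>y\<close>. Thus the coefficient
  of \<open>x\<^sup>i y\<^sup>j\<close> in \<open>P\<close> is \<open>coeff (coeff P j) i\<close>.
\<close>

definition cst :: "'a::field \<Rightarrow> 'a poly poly" where
  "cst a = [:[:a:]:]"

definition pX :: "'a::field poly poly" where
  "pX = [:[:0, 1:]:]"

definition pY :: "'a::field poly poly" where
  "pY = [:0, 1:]"

definition linear_forms :: "'a::field poly poly set" where
  "linear_forms = {cst p * pX + cst q * pY | p q. True}"

definition binary_cubics :: "'a::field poly poly set" where
  "binary_cubics =
     {cst a * pX^3 + 3 * cst b * pX^2 * pY + 3 * cst c * pX * pY^2 + cst d * pY^3 | a b c d. True}"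

text \<open>
  The coefficients \<open>a, b, c, d\<close> of \<open>a x\<^sup>3 + 3 b x\<^sup>2 y + 3 c x y\<^sup>2 + d y\<^sup>3\<close>,
  in characteristic not three.
\<close>

definition cub_a :: "'a::field poly poly \<Rightarrow> 'a" where
  "cub_a P = coeff (coeff P 0) 3"

definition cub_b :: "'a::field poly poly \<Rightarrow> 'a" where
  "cub_b P = coeff (coeff P 1) 2 / 3"

definition cub_c :: "'a::field poly poly \<Rightarrow> 'a" where
  "cub_c P = coeff (coeff P 2) 1 / 3"

definition cub_d :: "'a::field poly poly \<Rightarrow> 'a" where
  "cub_d P = coeff (coeff P 3) 0"

definition omega :: "'a::field poly poly \<Rightarrow> 'a poly poly \<Rightarrow> 'a" where
  "omega P P' = cub_a P * cub_d P' - cub_d P * cub_a P'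
              - 3 * cub_b P * cub_c P' + 3 * cub_c P * cub_b P'"

definition Qn :: "'a::field poly poly \<Rightarrow> 'a" where
  "Qn P = (cub_a P)^2 * (cub_d P)^2 - 3 * (cub_b P)^2 * (cub_c P)^2
        - 6 * cub_a P * cub_b P * cub_c P * cub_d P
        + 4 * (cub_b P)^3 * cub_d P + 4 * cub_a P * (cub_c P)^3"

definition SL2 :: "('a::field ^ 2 ^ 2) monoid" where
  "SL2 = \<lparr>carrier = {A. det A = 1}, monoid.mult = (**), one = mat 1\<rparr>"

definition poly_subst :: "'a::field poly poly \<Rightarrow> 'a poly poly \<Rightarrow> 'a poly poly \<Rightarrow> 'a poly poly" where
  "poly_subst P u v = poly (map_poly (\<lambda>p. poly (map_poly cst p) u) P) v"

text \<open>
  The algebra automorphism extending \<open>\<phi> \<mapsto> \<phi> \<circ> g\<^sup>-\<^sup>1\<close> on linear forms: it sends \<open>x\<close> and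
  \<open>y\<close> to the linear forms given by the two rows of \<open>g\<^sup>-\<^sup>1\<close>.
\<close>

definition act :: "'a::field ^ 2 ^ 2 \<Rightarrow> 'a poly poly \<Rightarrow> 'a poly poly" where
  "act g P = (let h = matrix_inv g in
     poly_subst P (cst (h $ 1 $ 1) * pX + cst (h $ 1 $ 2) * pY)
             (cst (h $ 2 $ 1) * pX + cst (h $ 2 $ 2) * pY))"

definition eval2 :: "'a::field poly poly \<Rightarrow> 'a ^ 2 \<Rightarrow> 'a" where
  "eval2 P v = poly (poly P [:v $ 2:]) (v $ 1)"

lemma eval2_simps [simp]:
  "eval2 (P + P') v = eval2 P v + eval2 P' v"
  "eval2 (P * P') v = eval2 P v * eval2 P' v"
  "eval2 (cst a) v = a" "eval2 pX v = v $ 1" "eval2 pY v = v $ 2" "eval2 0 v = 0"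
  by (simp_all add: eval2_def cst_def pX_def pY_def)

lemma eval2_act: "eval2 (act g P) v = eval2 P (matrix_inv g *v v)"
proof -
  have inner: "eval2 (poly (map_poly cst p) u) v = poly p (eval2 u v)"
    for p :: "'a poly" and u v
    by (induction p) (simp_all add: map_poly_pCons cst_def[of 0])
  have "eval2 (poly_subst P u w) v = poly (poly P [:eval2 w v:]) (eval2 u v)" for u w
    unfolding poly_subst_def
    by (induction P) (simp_all add: map_poly_pCons inner)
  then show ?thesis
    by (simp add: act_def Let_def eval2_def[of P] matrix_vector_mult_def sum_2)
qed

definition base_ext :: "('a::field \<Rightarrow> 'b::field) \<Rightarrow> 'a poly poly \<Rightarrow> 'b poly poly" where
  "base_ext f = map_poly (map_poly f)"


section \<open>The invariant\<close>

definition O_cubics :: "('k::field \<Rightarrow> 'K::field) \<Rightarrow> 'k poly poly set" where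
  "O_cubics \<iota> = {P \<in> binary_cubics. splitting_field \<iota> [:- Qn P, 0, 1:]}"

definition Im_star :: "('k::field \<Rightarrow> 'K::field) \<Rightarrow> 'K set" where
  "Im_star \<iota> = {\<xi>. gal_conj \<iota> \<xi> = - \<xi> \<and> \<xi> \<noteq> 0}"

definition mult_grp :: "'a::field monoid" where
  "mult_grp = \<lparr>carrier = {z. z \<noteq> 0}, monoid.mult = (*), one = 1\<rparr>"

definition nonzero_cubes :: "'a::field set" where
  "nonzero_cubes = {z^3 | z. z \<noteq> 0}"

definition mod_cubes :: "'a::field set monoid" where
  "mod_cubes = mult_grp Mod nonzero_cubes"

definition cube_class :: "'a::field \<Rightarrow> 'a set" where
  "cube_class z = nonzero_cubes #>\<^bsub>mult_grp\<^esub> z"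

text \<open>Elements of the quotient group are cosets, on which conjugation acts by direct image.\<close>

definition U_grp :: "('k::field \<Rightarrow> 'K::field) \<Rightarrow> 'K set set" where
  "U_grp \<iota> = {\<alpha> \<in> carrier mod_cubes. \<alpha> \<otimes>\<^bsub>mod_cubes\<^esub> (gal_conj \<iota> ` \<alpha>) = \<one>\<^bsub>mod_cubes\<^esub>}"

definition Z2_rel :: "('k::field \<Rightarrow> 'K::field) \<Rightarrow> (('K \<times> 'K set) \<times> ('K \<times> 'K set)) set" where
  "Z2_rel \<iota> = {((\<xi>, \<alpha>), (\<xi>', \<alpha>')). (\<xi>, \<alpha>) \<in> Im_star \<iota> \<times> U_grp \<iota> \<and>
     ((\<xi>', \<alpha>') = (\<xi>, \<alpha>) \<or> (\<xi>', \<alpha>') = (- \<xi>, inv\<^bsub>mod_cubes\<^esub> \<alpha>))}"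

definition Im_times_U :: "('k::field \<Rightarrow> 'K::field) \<Rightarrow> ('K \<times> 'K set) set set" where
  "Im_times_U \<iota> = (Im_star \<iota> \<times> U_grp \<iota>) // Z2_rel \<iota>"

definition Z2_class :: "('k::field \<Rightarrow> 'K::field) \<Rightarrow> 'K \<Rightarrow> 'K set \<Rightarrow> ('K \<times> 'K set) set" where
  "Z2_class \<iota> \<xi> \<alpha> = Z2_rel \<iota> `` {(\<xi>, \<alpha>)}"

text \<open>
  The value does not depend on the chosen decomposition of \<open>P\<close>, hence the definite
  description; it is meaningful on \<open>O_cubics \<iota>\<close> only.
\<close>

definition I_inv :: "('k::field \<Rightarrow> 'K::field) \<Rightarrow> 'k poly poly \<Rightarrow> ('K \<times> 'K set) set" where
  "I_inv \<iota> P = (THE c. \<exists>l \<alpha>. l \<noteq> 0 \<and> \<alpha> \<in> linear_forms \<and>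
     (let T = cst l * \<alpha>^3; T' = cst (gal_conj \<iota> l) * (base_ext (gal_conj \<iota>) \<alpha>)^3 in
       base_ext \<iota> P = T + T' \<and>
       c = Z2_class \<iota> (omega T T') (cube_class (l * inverse (gal_conj \<iota> l)))))"

definition unitary_cube_roots_grp :: "('k::field \<Rightarrow> 'K::field) \<Rightarrow> ('K ^ 2 ^ 2) monoid" where
  "unitary_cube_roots_grp \<iota> = SL2\<lparr>carrier := {A \<in> carrier SL2.
     \<exists>l. A = vector [vector [l, 0], vector [0, gal_conj \<iota> l]] \<and> l^3 = 1 \<and> l * gal_conj \<iota> l = 1}\<rparr>"

end

theory Submission
  imports Defs
begin

text \<open>
  Let a bar denote conjugation. A cubic in \<open>O_cubics\<close> becomes a sum of two conjugate cubes
  \<open>T + T'\<close> over the extension, with \<open>T = l (p x + q y)\<^sup>3\<close>: the two linear forms are the factors of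
  its Hessian, whose discriminant is \<open>Qn\<close> (\<open>O_cubics_normal_form\<close>). The pairing \<open>w\<close> of \<open>T\<close> and \<open>T'\<close> is
  the norm of \<open>l\<close> times the cube of the bracket, that is, of the determinant of the two linear forms.
  Its square is \<open>Qn\<close>, and the cubic covariant of the cubic is \<open>w (T - T')\<close>. Hence the cubic and a
  choice of the square root \<open>w\<close> of \<open>Qn\<close> determine \<open>T\<close>, and the other choice exchanges \<open>T\<close> and \<open>T'\<close>
  (\<open>summand_unique\<close>). The quotient by the group of order two absorbs this choice, so the
  invariant is well defined.

  The group acts on the linear forms and does not change \<open>l\<close> or the bracket, so the invariant is
  constant on orbits. Conversely, two linear forms whose brackets agree and do not vanish are
  carried into each other by a unique element of the group over the base field
  (\<open>SL2_transitive\<close>); it remains to see that equal invariants allow one to choose decompositions with equal \<open>l\<close> and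
  equal brackets. The quotient \<open>m\<close> of the two scalars has a norm that is a cube, since the pairings agree, and
  a quotient by its conjugate that is a cube, since the classes agree. So \<open>m\<^sup>2\<close> is a cube, and therefore
  \<open>m\<close> itself is one, because two and three are coprime (\<open>SL2_conjugate\<close>). The same arithmetic
  produces a cubic for each value of the invariant (\<open>I_inv_surj\<close>).

  A group element that fixes the cubic preserves the pairing, so it fixes \<open>T\<close> rather than exchanging
  \<open>T\<close> and \<open>T'\<close>, and it multiplies the linear form by a cube root of unity of norm one; transitivity
  shows that each of these occurs (\<open>stabilizer_iso\<close>).
\<close>

section \<open>Homomorphisms of fields\<close>

lemma of_nat_prime_neq_zero:
  assumes "CHAR('a::idom) \<noteq> p" and "prime p"
  shows "of_nat p \<noteq> (0::'a)"
  using assms by (auto simp: of_nat_eq_0_iff_char_dvd prime_nat_iff)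

locale field_morphism =
  fixes f :: "'a::field \<Rightarrow> 'b::field"
  assumes hom: "field_hom f"
begin

lemma one [simp]: "f 1 = 1" and add [simp]: "f (a + b) = f a + f b"
  and mult [simp]: "f (a * b) = f a * f b"
  using hom by (auto simp: field_hom_def)

lemma zero [simp]: "f 0 = 0"
  using add[of 0 0] by (metis add.right_neutral add_cancel_right_right)

lemma minus [simp]: "f (- a) = - f a"
  using add[of a "- a"] by (simp add: eq_neg_iff_add_eq_0 add.commute)

lemma diff [simp]: "f (a - b) = f a - f b"
  using add[of a "- b"] by simp

lemma power [simp]: "f (a ^ n) = f a ^ n"
  by (induction n) auto

lemma eq_zero_iff [simp]: "f a = 0 \<longleftrightarrow> a = 0"
proof
  show "a = 0" if "f a = 0"
    using that mult[of a "inverse a"] by (cases "a = 0") auto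
qed simp

lemma eq_iff [simp]: "f a = f b \<longleftrightarrow> a = b"
  using eq_zero_iff[of "a - b"] by (simp del: eq_zero_iff)

lemma inverse [simp]: "f (inverse a) = inverse (f a)"
proof (cases "a = 0")
  case False
  then show ?thesis
    using mult[of a "inverse a"] by (simp add: field_simps)
qed simp

lemma divide [simp]: "f (a / b) = f a / f b"
  by (simp add: divide_inverse)

lemma numeral [simp]: "f (numeral n) = numeral n"
proof -
  have "f (of_nat m) = of_nat m" for m by (induction m) auto
  from this[of "numeral n"] show ?thesis by simp
qed

end


section \<open>Conjugation in a quadratic extension\<close>

locale quadratic_field =
  fixes \<iota> :: "'k::field \<Rightarrow> 'K::field"
  assumes two: "(2::'k) \<noteq> 0" and three: "(3::'k) \<noteq> 0"
    and quadratic: "quadratic_extension \<iota>"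
begin

sublocale \<iota>: field_morphism \<iota>
  using quadratic by unfold_locales (simp add: quadratic_extension_def)

lemma two' [simp]: "(2::'K) \<noteq> 0"
  using \<iota>.eq_zero_iff[of 2] two by (simp del: \<iota>.eq_zero_iff)

lemma four' [simp]: "(4::'K) \<noteq> 0"
proof -
  have "(4::'K) = 2 * 2" by simp
  then show ?thesis by (metis mult_eq_0_iff two')
qed

lemma three' [simp]: "(3::'K) \<noteq> 0"
  using \<iota>.eq_zero_iff[of 3] three by (simp del: \<iota>.eq_zero_iff)

text \<open>
  Completing the square in the quadratic equation of a second basis vector; the division by two
  is where characteristic two must be excluded.
\<close>

lemma imaginary_generator:
  obtains w D where "w \<notin> range \<iota>" "w\<^sup>2 = \<iota> D" "\<And>z. \<exists>x y. z = \<iota> x + \<iota> y * w"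
proof -
  interpret V: vector_space "\<lambda>a z. \<iota> a * z"
    by unfold_locales (auto simp: algebra_simps)
  have dim: "V.dim UNIV = 2"
    using quadratic by (simp add: quadratic_extension_def)
  have ind: "V.independent {1}"
    by simp
  define B where "B = V.extend_basis {1}"
  have B: "1 \<in> B" "V.independent B" "V.span B = UNIV"
    using V.extend_basis_superset[OF ind] V.independent_extend_basis[OF ind] V.span_extend_basis[OF ind]
    by (auto simp: B_def)
  have "card B = 2"
    using V.basis_card_eq_dim[of B UNIV] B dim by auto
  then obtain v where v: "B = {1, v}" "v \<noteq> 1"
    using B(1) by (metis card_2_iff doubleton_eq_iff insertE singletonD)
  have span: "\<exists>x y. z = \<iota> x + \<iota> y * v" for z
  proof -
    have "z \<in> V.span {1, v}" using B(3) v by auto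
    then obtain x where "z - \<iota> x * 1 \<in> V.span {v}" using V.span_breakdown_eq by metis
    then obtain y where "z - \<iota> x * 1 = \<iota> y * v" by (auto simp: V.span_singleton)
    then show ?thesis by (metis add.commute diff_add_cancel mult.right_neutral)
  qed
  have v_notin: "v \<notin> range \<iota>"
  proof
    assume "v \<in> range \<iota>"
    moreover have "B - {v} = {1}" using v by auto
    ultimately have "v \<in> V.span (B - {v})" by (auto simp: V.span_singleton)
    then show False using B(2) v by (auto simp: V.dependent_def)
  qed
  obtain g h where gh: "v\<^sup>2 = \<iota> g + \<iota> h * v" using span by blast
  define w where "w = v - \<iota> (h / 2)"
  have "w \<notin> range \<iota>"
  proof
    assume "w \<in> range \<iota>"
    then obtain a where "v - \<iota> (h / 2) = \<iota> a" by (auto simp: w_def)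
    then have "v = \<iota> (a + h / 2)" by (simp add: diff_eq_eq)
    with v_notin show False by blast
  qed
  moreover have "w\<^sup>2 = \<iota> (g + h\<^sup>2 / 4)"
  proof -
    have "w\<^sup>2 = v\<^sup>2 - \<iota> h * v + \<iota> h ^ 2 / 4"
      by (simp add: w_def power2_eq_square field_simps)
    then show ?thesis by (simp add: gh)
  qed
  moreover have "\<exists>x y. z = \<iota> x + \<iota> y * w" for z
  proof -
    obtain x y where "z = \<iota> x + \<iota> y * v" using span by blast
    then have "z = \<iota> (x + y * h / 2) + \<iota> y * w" by (simp add: w_def algebra_simps)
    then show ?thesis by blast
  qed
  ultimately show thesis using that by blast
qed

abbreviation conj ("_\<^sup>\<star>" [1000] 1000) where "z\<^sup>\<star> \<equiv> gal_conj \<iota> z"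

text \<open>
  An automorphism over the base field can only send \<open>w\<close> to \<open>w\<close> or \<open>- w\<close>, because \<open>w\<^sup>2\<close> is fixed;
  the second choice does define an automorphism. Hence the Galois group has exactly one
  nontrivial element, and the definite description of \<open>gal_conj\<close> denotes it.
\<close>

lemma ex1_conjugation:
  assumes w: "w \<notin> range \<iota>" "w\<^sup>2 = \<iota> D" "\<And>z. \<exists>x y. z = \<iota> x + \<iota> y * w"
  shows "\<exists>!\<sigma>. \<sigma> \<in> Gal \<iota> \<and> \<sigma> \<noteq> id"
    and "\<sigma> \<in> Gal \<iota> \<Longrightarrow> \<sigma> \<noteq> id \<Longrightarrow> \<sigma> (\<iota> x + \<iota> y * w) = \<iota> x - \<iota> y * w"
proof -
  have w0: "w \<noteq> 0" using w(1) \<iota>.zero by (metis rangeI)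
  have uniq: "x = x' \<and> y = y'" if eq: "\<iota> x + \<iota> y * w = \<iota> x' + \<iota> y' * w" for x y x' y'
  proof -
    have e: "\<iota> (y - y') * w = \<iota> (x' - x)" using eq by (simp add: algebra_simps)
    have "y = y'"
    proof (rule ccontr)
      assume "y \<noteq> y'"
      then have "w = \<iota> ((x' - x) / (y - y'))" using e by (simp add: field_simps)
      with w(1) show False by blast
    qed
    with e show ?thesis by simp
  qed
  have formula: "\<sigma> (\<iota> x + \<iota> y * w) = \<iota> x - \<iota> y * w" if "\<sigma> \<in> Gal \<iota>" "\<sigma> \<noteq> id" for \<sigma> x y
  proof -
    interpret s: field_morphism \<sigma> using that by unfold_locales (simp add: Gal_def)
    have base: "\<sigma> (\<iota> a) = \<iota> a" for a using that by (simp add: Gal_def)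
    have "(\<sigma> w)\<^sup>2 = w\<^sup>2" using base[of D] by (simp flip: s.power add: w(2))
    then have "\<sigma> w = w \<or> \<sigma> w = - w" by (simp add: power2_eq_iff)
    moreover have "\<sigma> w \<noteq> w"
    proof
      assume "\<sigma> w = w"
      then have "\<sigma> z = z" for z using w(3)[of z] base by auto
      with that show False by auto
    qed
    ultimately show ?thesis using base by simp
  qed
  then show "\<sigma> \<in> Gal \<iota> \<Longrightarrow> \<sigma> \<noteq> id \<Longrightarrow> \<sigma> (\<iota> x + \<iota> y * w) = \<iota> x - \<iota> y * w" .
  define \<tau> where "\<tau> z = (THE u. \<exists>x y. z = \<iota> x + \<iota> y * w \<and> u = \<iota> x - \<iota> y * w)" for z
  have \<tau>: "\<tau> (\<iota> x + \<iota> y * w) = \<iota> x - \<iota> y * w" for x y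
    unfolding \<tau>_def by (rule the_equality) (auto dest: uniq)
  have "\<tau> (z + z') = \<tau> z + \<tau> z' \<and> \<tau> (z * z') = \<tau> z * \<tau> z'" for z z'
  proof -
    obtain x y x' y' where z: "z = \<iota> x + \<iota> y * w" "z' = \<iota> x' + \<iota> y' * w" using w(3) by metis
    have a: "z + z' = \<iota> (x + x') + \<iota> (y + y') * w" by (simp add: z algebra_simps)
    have "z * z' = \<iota> x * \<iota> x' + \<iota> y * \<iota> y' * w\<^sup>2 + (\<iota> x * \<iota> y' + \<iota> y * \<iota> x') * w"
      by (simp add: z algebra_simps power2_eq_square)
    then have m: "z * z' = \<iota> (x * x' + y * y' * D) + \<iota> (x * y' + y * x') * w"
      by (simp add: w(2))
    have "\<tau> z * \<tau> z' = \<iota> x * \<iota> x' + \<iota> y * \<iota> y' * w\<^sup>2 - (\<iota> x * \<iota> y' + \<iota> y * \<iota> x') * w"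
      unfolding z \<tau> by (simp add: algebra_simps power2_eq_square)
    then have m': "\<tau> z * \<tau> z' = \<iota> (x * x' + y * y' * D) - \<iota> (x * y' + y * x') * w"
      by (simp add: w(2))
    have "\<tau> (z + z') = \<tau> z + \<tau> z'"
      unfolding a \<tau> unfolding z \<tau> by (simp add: algebra_simps)
    moreover have "\<tau> (z * z') = \<tau> z * \<tau> z'"
      unfolding m m' \<tau> ..
    ultimately show ?thesis ..
  qed
  moreover have fixed: "\<tau> (\<iota> a) = \<iota> a" for a using \<tau>[of a 0] by simp
  moreover have inv: "\<tau> (\<tau> z) = z" for z
  proof -
    obtain x y where z: "z = \<iota> x + \<iota> y * w" using w(3) by metis
    show ?thesis using \<tau>[of x "- y"] by (simp add: z \<tau>)
  qed
  ultimately have "\<tau> \<in> Gal \<iota>"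
    using fixed[of 1] by (auto simp: Gal_def field_hom_def intro!: o_bij[of \<tau> \<tau>])
  moreover have "\<tau> \<noteq> id"
  proof
    assume "\<tau> = id"
    then have "w = - w" using \<tau>[of 0 1] by simp
    then have "2 * w = 0" by (metis add.right_inverse mult_2)
    then show False using w0 by simp
  qed
  moreover have "\<sigma> = \<tau>" if "\<sigma> \<in> Gal \<iota>" "\<sigma> \<noteq> id" for \<sigma>
  proof
    fix z
    obtain x y where z: "z = \<iota> x + \<iota> y * w" using w(3) by metis
    show "\<sigma> z = \<tau> z" using formula[OF that] \<tau> by (simp add: z)
  qed
  ultimately show "\<exists>!\<sigma>. \<sigma> \<in> Gal \<iota> \<and> \<sigma> \<noteq> id" by blast
qed

lemma conj_in_Gal: "gal_conj \<iota> \<in> Gal \<iota> \<and> gal_conj \<iota> \<noteq> id"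
proof -
  obtain w D where w: "w \<notin> range \<iota>" "w\<^sup>2 = \<iota> D" "\<And>z. \<exists>x y. z = \<iota> x + \<iota> y * w"
    using imaginary_generator by metis
  show ?thesis unfolding gal_conj_def by (rule theI'[OF ex1_conjugation(1)[OF w]])
qed

sublocale conj: field_morphism "gal_conj \<iota>"
  using conj_in_Gal by unfold_locales (simp add: Gal_def)

lemma conj_base [simp]: "(\<iota> a)\<^sup>\<star> = \<iota> a"
  using conj_in_Gal by (simp add: Gal_def)

lemma conjugation_generator:
  obtains w where "w \<noteq> 0" "w\<^sup>\<star> = - w" "\<And>z. \<exists>x y. z = \<iota> x + \<iota> y * w"
proof -
  obtain w D where w: "w \<notin> range \<iota>" "w\<^sup>2 = \<iota> D" "\<And>z. \<exists>x y. z = \<iota> x + \<iota> y * w"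
    using imaginary_generator by metis
  have "w\<^sup>\<star> = - w"
    using ex1_conjugation(2)[OF w, of "gal_conj \<iota>" 0 1] conj_in_Gal by simp
  moreover have "w \<noteq> 0" using w(1) \<iota>.zero by (metis rangeI)
  ultimately show thesis using w(3) that by blast
qed

lemma conj_conj [simp]: "z\<^sup>\<star>\<^sup>\<star> = z"
proof -
  obtain w where w: "w\<^sup>\<star> = - w" "\<And>z. \<exists>x y. z = \<iota> x + \<iota> y * w"
    using conjugation_generator by metis
  obtain x y where "z = \<iota> x + \<iota> y * w" using w(2) by metis
  then show ?thesis by (simp add: w(1))
qed

lemma double_eq_zero [simp]: "z + z = 0 \<longleftrightarrow> z = (0::'K)"
  by (metis mult_2 mult_eq_0_iff two')

lemma neq_minus [simp]: "z = - z \<longleftrightarrow> z = (0::'K)" "- z = z \<longleftrightarrow> z = (0::'K)"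
  by (metis double_eq_zero add.right_inverse neg_eq_iff_add_eq_0 add_eq_0_iff2)+

text \<open>
  This descends identities from the extension: a quantity that is computed upstairs and is
  invariant under conjugation comes from the base field.
\<close>

lemma conj_fixed_iff: "z\<^sup>\<star> = z \<longleftrightarrow> z \<in> range \<iota>"
proof
  assume z: "z\<^sup>\<star> = z"
  obtain w where w: "w\<^sup>\<star> = - w" "w \<noteq> 0" "\<And>z. \<exists>x y. z = \<iota> x + \<iota> y * w"
    using conjugation_generator by metis
  obtain x y where xy: "z = \<iota> x + \<iota> y * w" using w(3) by metis
  with z have "\<iota> y * w = 0" by (simp add: w(1))
  with xy show "z \<in> range \<iota>" by simp
qed auto

lemma conj_fixedE:
  assumes "z\<^sup>\<star> = z" obtains a where "z = \<iota> a"
  using assms conj_fixed_iff by blast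

lemma imaginary_decomposition:
  assumes "t\<^sup>\<star> = - t" "t \<noteq> 0"
  obtains x y where "z = \<iota> x + \<iota> y * t"
proof -
  have "((z + z\<^sup>\<star>) / 2)\<^sup>\<star> = (z + z\<^sup>\<star>) / 2" by (simp add: add.commute)
  then obtain x where x: "(z + z\<^sup>\<star>) / 2 = \<iota> x" by (rule conj_fixedE)
  have "((z - z\<^sup>\<star>) / (2 * t))\<^sup>\<star> = (z - z\<^sup>\<star>) / (2 * t)"
    using assms by (simp add: field_simps)
  then obtain y where y: "(z - z\<^sup>\<star>) / (2 * t) = \<iota> y" by (rule conj_fixedE)
  have "z = \<iota> x + \<iota> y * t" unfolding x[symmetric] y[symmetric]
    using assms by (simp add: field_simps)
  then show thesis by (rule that)
qed

text \<open>
  The roots \<open>t\<close> and \<open>- t\<close> generate the extension precisely when \<open>t\<close> is not in the base field.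
  As \<open>t\<^sup>2\<close> is in it, conjugation must then negate \<open>t\<close>. So the set \<open>O_cubics\<close> consists of the cubics
  whose \<open>Qn\<close> is the square of a nonzero imaginary element.
\<close>

lemma splitting_field_iff:
  "splitting_field \<iota> [:- D, 0, 1:] \<longleftrightarrow> (\<exists>t. t \<noteq> 0 \<and> t\<^sup>\<star> = - t \<and> t\<^sup>2 = \<iota> D)"
proof -
  have map: "map_poly \<iota> [:- D, 0, 1:] = [:- \<iota> D, 0, 1:]"
    by (simp add: map_poly_pCons)
  have root: "poly [:- \<iota> D, 0, 1:] r = 0 \<longleftrightarrow> r\<^sup>2 = \<iota> D" for r
    by (auto simp: power2_eq_square)
  show ?thesis
  proof
    assume "splitting_field \<iota> [:- D, 0, 1:]"
    then obtain c rs where c: "[:- \<iota> D, 0, 1:] = smult c (\<Prod>r\<leftarrow>rs. [:- r, 1:])"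
      and gen: "\<And>F. subfield_set F \<Longrightarrow> range \<iota> \<union> {r. r\<^sup>2 = \<iota> D} \<subseteq> F \<Longrightarrow> F = UNIV"
      unfolding splitting_field_def map root by blast
    have "rs \<noteq> []"
    proof
      assume "rs = []"
      then have "degree [:- \<iota> D, 0, 1:] = degree [:c:]" using c by simp
      then show False by simp
    qed
    then obtain t ts where "rs = t # ts" by (cases rs) auto
    then have "poly [:- \<iota> D, 0, 1:] t = 0" unfolding c by simp
    then have t: "t\<^sup>2 = \<iota> D" unfolding root .
    have "t\<^sup>\<star> ^ 2 = t\<^sup>2" by (simp flip: conj.power add: t)
    then have "t\<^sup>\<star> = t \<or> t\<^sup>\<star> = - t" by (simp add: power2_eq_iff)
    moreover have "t\<^sup>\<star> \<noteq> t"
    proof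
      assume "t\<^sup>\<star> = t"
      then obtain a where a: "t = \<iota> a" by (rule conj_fixedE)
      have "r = t \<or> r = - t" if "r\<^sup>2 = \<iota> D" for r
        using that t by (metis power2_eq_iff)
      then have "{r. r\<^sup>2 = \<iota> D} \<subseteq> range \<iota>"
        unfolding a by (auto simp flip: \<iota>.minus)
      moreover have "subfield_set (range \<iota>)"
        unfolding subfield_set_def
        by (auto simp flip: \<iota>.diff \<iota>.mult \<iota>.inverse intro: range_eqI[of 1 \<iota> 1])
      ultimately have "range \<iota> = UNIV" by (intro gen) auto
      moreover obtain w where "w \<noteq> 0" "w\<^sup>\<star> = - w" using conjugation_generator by metis
      ultimately show False using conj_fixed_iff[of w] by auto
    qed
    ultimately show "\<exists>t. t \<noteq> 0 \<and> t\<^sup>\<star> = - t \<and> t\<^sup>2 = \<iota> D" using t by (metis conj.zero)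
  next
    assume "\<exists>t. t \<noteq> 0 \<and> t\<^sup>\<star> = - t \<and> t\<^sup>2 = \<iota> D"
    then obtain t where t: "t \<noteq> 0" "t\<^sup>\<star> = - t" "t\<^sup>2 = \<iota> D" by blast
    show "splitting_field \<iota> [:- D, 0, 1:]"
      unfolding splitting_field_def map root
    proof (intro conjI allI impI exI)
      show "[:- \<iota> D, 0, 1:] = smult 1 (\<Prod>r\<leftarrow>[t, - t]. [:- r, 1:])"
        by (simp add: t(3)[symmetric] power2_eq_square)
    next
      fix F assume F: "subfield_set F \<and> range \<iota> \<union> {r. r\<^sup>2 = \<iota> D} \<subseteq> F"
      have closed: "a - b \<in> F" "a * b \<in> F" if "a \<in> F" "b \<in> F" for a b
        using F that by (auto simp: subfield_set_def)
      have "z \<in> F" for z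
      proof -
        obtain x y where z: "z = \<iota> x + \<iota> y * t" using imaginary_decomposition[OF t(2,1)] .
        have "\<iota> x - \<iota> (- y) * t \<in> F" using F t by (intro closed) (auto simp flip: \<iota>.minus)
        then show ?thesis by (simp add: z)
      qed
      then show "F = UNIV" by blast
    qed
  qed
qed

end


section \<open>Binary cubics in coordinates\<close>

lemma map_poly_add_hom:
  assumes "f 0 = 0" "\<And>a b. f (a + b) = f a + f b"
  shows "map_poly f (p + q) = map_poly f p + map_poly f q"
  by (intro poly_eqI) (simp add: assms coeff_map_poly)

lemma map_poly_mult_hom:
  fixes f :: "'a::comm_semiring_0 \<Rightarrow> 'b::comm_semiring_0"
  assumes "f 0 = 0" "\<And>a b. f (a + b) = f a + f b" "\<And>a b. f (a * b) = f a * f b"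
  shows "map_poly f (p * q) = map_poly f p * map_poly f q"
proof (induction p)
  case (pCons a p)
  have "map_poly f (smult a q) = smult (f a) (map_poly f q)"
    by (rule map_poly_smult) (simp_all add: assms)
  with pCons show ?case
    by (simp add: map_poly_pCons map_poly_add_hom assms)
qed simp

definition lin :: "'a::field \<Rightarrow> 'a \<Rightarrow> 'a poly poly" where
  "lin p q = cst p * pX + cst q * pY"

definition cubic :: "'a::field \<Rightarrow> 'a \<Rightarrow> 'a \<Rightarrow> 'a \<Rightarrow> 'a poly poly" where
  "cubic a b c d = cst a * pX^3 + 3 * cst b * pX^2 * pY + 3 * cst c * pX * pY^2 + cst d * pY^3"

lemma linear_forms_lin: "linear_forms = {lin p q | p q. True}"
  by (simp add: linear_forms_def lin_def)

lemma binary_cubics_cubic: "binary_cubics = {cubic a b c d | a b c d. True}"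
  by (simp add: binary_cubics_def cubic_def)

lemma cst_simps [simp]: "cst 0 = 0" "cst 1 = 1"
  and cst_add: "cst (a + b) = cst a + cst b"
  and cst_mult: "cst (a * b) = cst a * cst b"
  by (simp_all add: cst_def one_pCons)

lemma cst_power: "cst (a ^ n) = cst a ^ n"
  by (induction n) (simp_all add: cst_mult)

lemma cst_numeral: "numeral n = cst (numeral n)"
  by (simp add: cst_def numeral_poly)

lemma cubic_coefficients:
  "cubic a b c d = [:[:0, 0, 0, a:], [:0, 0, 3 * b:], [:0, 3 * c:], [:d:]:]"
  by (simp add: cubic_def cst_def pX_def pY_def numeral_poly power3_eq_cube power2_eq_square)

lemma cub_cubic [simp]:
  assumes "(3::'a::field) \<noteq> 0"
  shows "cub_a (cubic a b c d) = (a::'a)" "cub_b (cubic a b c d) = b"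
    "cub_c (cubic a b c d) = c" "cub_d (cubic a b c d) = d"
  using assms
  by (simp_all add: cubic_coefficients cub_a_def cub_b_def cub_c_def cub_d_def numeral_eq_Suc)

lemma cubic_eq_iff:
  assumes "(3::'a::field) \<noteq> 0"
  shows "cubic a b c (d::'a) = cubic a' b' c' d' \<longleftrightarrow> a = a' \<and> b = b' \<and> c = c' \<and> d = d'"
  using cub_cubic[OF assms] by metis

lemma cubic_add: "cubic a b c d + cubic a' b' c' d' = cubic (a + a') (b + b') (c + c') (d + d')"
  by (simp add: cubic_def cst_add algebra_simps)

lemma scaled_cube: "cst l * lin p q ^ 3 = cubic (l * p^3) (l * p^2 * q) (l * p * q^2) (l * q^3)"
  by (simp add: cubic_def lin_def cst_mult cst_power power3_eq_cube power2_eq_square algebra_simps)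

lemma Qn_cubic:
  assumes "(3::'a::field) \<noteq> 0"
  shows "Qn (cubic a b c d) = a\<^sup>2 * d\<^sup>2 - 3 * b\<^sup>2 * c\<^sup>2 - 6 * a * b * c * d + 4 * b^3 * d + 4 * a * (c::'a)^3"
  using assms by (simp add: Qn_def)

text \<open>
  The pairing of the cubes of two linear forms is the cube of their determinant; invariance of the
  pairing under \<open>SL2\<close> is immediate from this form.
\<close>

lemma omega_scaled_cubes:
  assumes "(3::'a::field) \<noteq> 0"
  shows "omega (cst l * lin p q ^ 3) (cst l' * lin p' q' ^ 3) = l * l' * (p * q' - q * (p'::'a)) ^ 3"
  unfolding scaled_cube omega_def using assms by (simp add: power3_eq_cube power2_eq_square algebra_simps)

context field_morphism
begin

lemma base_ext_hom [simp]:
  "base_ext f (P + Q) = base_ext f P + base_ext f Q"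
  "base_ext f (P * Q) = base_ext f P * base_ext f Q"
  "base_ext f (cst a) = cst (f a)" "base_ext f pX = pX" "base_ext f pY = pY"
  by (simp_all add: base_ext_def map_poly_add_hom map_poly_mult_hom map_poly_pCons
      cst_def pX_def pY_def)

lemma base_ext_power [simp]: "base_ext f (P ^ n) = base_ext f P ^ n"
  using base_ext_hom(3)[of 1] by (induction n) simp_all

lemma base_ext_numeral [simp]: "base_ext f (numeral n) = numeral n"
  by (simp add: cst_numeral)

lemma base_ext_lin [simp]: "base_ext f (lin p q) = lin (f p) (f q)"
  by (simp add: lin_def)

lemma base_ext_cubic [simp]: "base_ext f (cubic a b c d) = cubic (f a) (f b) (f c) (f d)"
  by (simp add: cubic_def)

lemma base_ext_coeff: "coeff (coeff (base_ext f P) i) j = f (coeff (coeff P i) j)"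
  by (simp add: base_ext_def coeff_map_poly)

lemma base_ext_inject: "base_ext f P = base_ext f Q \<longleftrightarrow> P = Q"
proof
  assume "base_ext f P = base_ext f Q"
  then have "f (coeff (coeff P i) j) = f (coeff (coeff Q i) j)" for i j
    by (metis base_ext_coeff)
  then show "P = Q" by (simp add: poly_eq_iff)
qed simp

end


section \<open>The action of the special linear group\<close>

lemma poly_subst_hom [simp]:
  "poly_subst (P + Q) u v = poly_subst P u v + poly_subst Q u v"
  "poly_subst (P * Q) u v = poly_subst P u v * poly_subst Q u v"
  "poly_subst (cst a) u v = cst a" "poly_subst pX u v = u" "poly_subst pY u v = v"
proof -
  let ?e = "\<lambda>p. poly (map_poly cst p) u"
  have e: "?e 0 = 0" "\<And>p q. ?e (p + q) = ?e p + ?e q" "\<And>p q. ?e (p * q) = ?e p * ?e q"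
    by (simp_all add: map_poly_add_hom map_poly_mult_hom cst_add cst_mult)
  show "poly_subst (P + Q) u v = poly_subst P u v + poly_subst Q u v"
    "poly_subst (P * Q) u v = poly_subst P u v * poly_subst Q u v"
    unfolding poly_subst_def using map_poly_add_hom[of ?e, OF e(1,2)] map_poly_mult_hom[of ?e, OF e]
    by simp_all
  show "poly_subst (cst a) u v = cst a" "poly_subst pX u v = u" "poly_subst pY u v = v"
    by (simp_all add: poly_subst_def cst_def pX_def pY_def map_poly_pCons flip: one_pCons)
qed

lemma poly_subst_one [simp]: "poly_subst 1 u v = 1"
  using poly_subst_hom(3)[of 1 u v] by simp

lemma poly_subst_power [simp]: "poly_subst (P ^ n) u v = poly_subst P u v ^ n"
  by (induction n) simp_all

lemma poly_subst_numeral [simp]: "poly_subst (numeral n) u v = numeral n"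
  by (simp add: cst_numeral)

text \<open>
  The inverse is the adjugate, so the action is given by polynomials in the entries and
  commutes with extension of the field.
\<close>

lemma matrix_inv_SL2:
  fixes g :: "'a::field ^ 2 ^ 2"
  assumes "det g = 1"
  shows "matrix_inv g = vector [vector [g$2$2, - g$1$2], vector [- g$2$1, g$1$1]]"
proof -
  let ?h = "vector [vector [g$2$2, - g$1$2], vector [- g$2$1, g$1$1]] :: 'a ^ 2 ^ 2"
  have d: "g$1$1 * g$2$2 - g$1$2 * g$2$1 = 1"
    using assms by (simp add: det_2)
  have h: "g ** ?h = mat 1" "?h ** g = mat 1"
    using d by (simp_all add: vec_eq_iff forall_2 matrix_matrix_mult_def sum_2 mat_def algebra_simps)
  have "g ** matrix_inv g = mat 1 \<and> matrix_inv g ** g = mat 1"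
    unfolding matrix_inv_def by (rule someI[of _ ?h]) (use h in blast)
  then have "matrix_inv g ** (g ** ?h) = ?h"
    by (simp add: matrix_mul_assoc)
  then show ?thesis
    by (simp add: h(1))
qed

lemma act_SL2:
  assumes "det g = 1"
  shows "act g P = poly_subst P (lin (g$2$2) (- g$1$2)) (lin (- g$2$1) (g$1$1))"
  by (simp add: act_def matrix_inv_SL2[OF assms] lin_def Let_def)

lemma lin_combination: "cst p * lin a b + cst q * lin c d = lin (p * a + q * c) (p * b + q * d)"
  by (simp add: lin_def cst_add cst_mult algebra_simps)

lemma poly_subst_lin: "poly_subst (lin p q) (lin a b) (lin c d) = lin (p * a + q * c) (p * b + q * d)"
  by (simp add: lin_def[of p q] lin_combination)

lemma poly_subst_cubic:
  "poly_subst (cubic a b c d) u v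
   = cst a * u ^ 3 + 3 * cst b * u ^ 2 * v + 3 * cst c * u * v ^ 2 + cst d * v ^ 3"
  by (simp add: cubic_def)

text \<open>
  The row vector of a linear form is multiplied by the inverse matrix from the right.
\<close>

lemma act_hom:
  assumes "det g = 1"
  shows "act g (P + Q) = act g P + act g Q"
    and "act g (cst l * lin p q ^ 3)
         = cst l * lin (p * g$2$2 - q * g$2$1) (q * g$1$1 - p * g$1$2) ^ 3"
  using assms by (simp_all add: act_SL2 poly_subst_lin)

lemma act_one:
  assumes "P \<in> binary_cubics" shows "act (mat 1) P = P"
proof -
  have "lin 1 0 = (pX :: 'a poly poly)" "lin 0 1 = (pY :: 'a poly poly)"
    by (simp_all add: lin_def)
  moreover have "act (mat 1) P = poly_subst P (lin 1 0) (lin 0 1)"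
    by (subst act_SL2, simp) (simp add: mat_def)
  ultimately show ?thesis
    using assms by (auto simp: binary_cubics_cubic poly_subst_cubic) (simp add: cubic_def)
qed

lemma act_mult:
  assumes "det g = 1" "det h = 1" "P \<in> binary_cubics"
  shows "act (g ** h) P = act g (act h P)"
proof -
  have "det (g ** h) = 1" using assms by (simp add: det_mul)
  then show ?thesis
    using assms by (auto simp: act_SL2 binary_cubics_cubic poly_subst_cubic poly_subst_lin
        matrix_matrix_mult_def sum_2 mult.commute add.commute)
qed

definition map_matrix :: "('a \<Rightarrow> 'b) \<Rightarrow> 'a ^ 'n ^ 'm \<Rightarrow> 'b ^ 'n ^ 'm" where
  "map_matrix f A = (\<chi> i j. f (A $ i $ j))"

lemma (in field_morphism) base_ext_act:
  assumes "det g = 1" "P \<in> binary_cubics"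
  shows "base_ext f (act g P) = act (map_matrix f g) (base_ext f P)"
proof -
  have "det (map_matrix f g) = f (det g)" by (simp add: map_matrix_def det_2)
  with assms show ?thesis
    by (auto simp: act_SL2 binary_cubics_cubic map_matrix_def poly_subst_cubic)
qed


section \<open>Classes modulo cubes\<close>

lemma comm_group_mult_grp: "comm_group (mult_grp :: 'a::field monoid)"
proof (rule comm_groupI)
  fix x :: 'a assume "x \<in> carrier mult_grp"
  then show "\<exists>y\<in>carrier mult_grp. y \<otimes>\<^bsub>mult_grp\<^esub> x = \<one>\<^bsub>mult_grp\<^esub>"
    by (intro bexI[of _ "inverse x"]) (auto simp: mult_grp_def)
qed (auto simp: mult_grp_def)

lemma inv_mult_grp: "(z::'a::field) \<noteq> 0 \<Longrightarrow> inv\<^bsub>mult_grp\<^esub> z = inverse z"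
proof -
  interpret comm_group "mult_grp :: 'a monoid" by (rule comm_group_mult_grp)
  show "z \<noteq> 0 \<Longrightarrow> inv\<^bsub>mult_grp\<^esub> z = inverse z"
    by (rule inv_equality) (auto simp: mult_grp_def)
qed

lemma normal_nonzero_cubes: "(nonzero_cubes :: 'a::field set) \<lhd> mult_grp"
proof -
  interpret comm_group "mult_grp :: 'a monoid" by (rule comm_group_mult_grp)
  have "subgroup nonzero_cubes (mult_grp :: 'a monoid)"
  proof (rule subgroupI)
    fix x y :: 'a assume x: "x \<in> nonzero_cubes"
    then obtain z where z: "z \<noteq> 0" "x = z ^ 3" by (auto simp: nonzero_cubes_def)
    then have "inverse x = inverse z ^ 3" "x \<noteq> 0" by (simp_all add: power_inverse)
    then show "inv\<^bsub>mult_grp\<^esub> x \<in> nonzero_cubes"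
      using z by (auto simp: inv_mult_grp nonzero_cubes_def intro: exI[of _ "inverse z"])
    assume "y \<in> nonzero_cubes"
    then obtain w where w: "w \<noteq> 0" "y = w ^ 3" by (auto simp: nonzero_cubes_def)
    then have "x * y = (z * w) ^ 3" using z by (simp add: power_mult_distrib)
    then show "x \<otimes>\<^bsub>mult_grp\<^esub> y \<in> nonzero_cubes"
      using w z by (auto simp: mult_grp_def nonzero_cubes_def)
  next
    have "(1::'a) ^ 3 \<in> nonzero_cubes" unfolding nonzero_cubes_def using one_neq_zero by blast
    then show "(nonzero_cubes :: 'a set) \<noteq> {}" by blast
  qed (auto simp: nonzero_cubes_def mult_grp_def)
  then show ?thesis by (rule subgroup_imp_normal)
qed

lemma mem_cube_class: "x \<in> cube_class z \<longleftrightarrow> (\<exists>u. u \<noteq> 0 \<and> x = u ^ 3 * z)"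
  by (auto simp: cube_class_def r_coset_def mult_grp_def nonzero_cubes_def)

lemma cube_class_eq_iff:
  assumes "z \<noteq> 0"
  shows "cube_class z = cube_class z' \<longleftrightarrow> (\<exists>u. u \<noteq> 0 \<and> z' = u ^ 3 * z)"
proof
  assume "cube_class z = cube_class z'"
  moreover have "z' \<in> cube_class z'" by (auto simp: mem_cube_class intro: exI[of _ 1])
  ultimately show "\<exists>u. u \<noteq> 0 \<and> z' = u ^ 3 * z" by (metis mem_cube_class)
next
  assume "\<exists>u. u \<noteq> 0 \<and> z' = u ^ 3 * z"
  then obtain u where u: "u \<noteq> 0" "z' = u ^ 3 * z" by blast
  have "(\<exists>v. v \<noteq> 0 \<and> x = v ^ 3 * z) \<longleftrightarrow> (\<exists>v. v \<noteq> 0 \<and> x = v ^ 3 * z')" for x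
  proof
    assume "\<exists>v. v \<noteq> 0 \<and> x = v ^ 3 * z"
    then obtain v where "v \<noteq> 0" "x = v ^ 3 * z" by blast
    then show "\<exists>v. v \<noteq> 0 \<and> x = v ^ 3 * z'"
      using u by (intro exI[of _ "v / u"]) (simp add: power_divide)
  next
    assume "\<exists>v. v \<noteq> 0 \<and> x = v ^ 3 * z'"
    then obtain v where "v \<noteq> 0" "x = v ^ 3 * z'" by blast
    then show "\<exists>v. v \<noteq> 0 \<and> x = v ^ 3 * z"
      using u by (intro exI[of _ "v * u"]) (simp add: power_mult_distrib)
  qed
  then show "cube_class z = cube_class z'" by (auto simp: mem_cube_class)
qed

lemma carrier_mod_cubes: "carrier mod_cubes = {cube_class z | z. z \<noteq> 0}"
  by (auto simp: mod_cubes_def carrier_FactGroup cube_class_def mult_grp_def)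

lemma one_mod_cubes: "\<one>\<^bsub>mod_cubes\<^esub> = cube_class (1::'a::field)"
  by (auto simp: mod_cubes_def mem_cube_class nonzero_cubes_def)

lemma mult_mod_cubes:
  assumes "z \<noteq> 0" "w \<noteq> (0::'a::field)"
  shows "cube_class z \<otimes>\<^bsub>mod_cubes\<^esub> cube_class w = cube_class (z * w)"
  using normal.rcos_sum[OF normal_nonzero_cubes, of z w] assms
  by (simp add: mod_cubes_def cube_class_def mult_grp_def)

lemma inv_mod_cubes:
  assumes "z \<noteq> (0::'a::field)"
  shows "inv\<^bsub>mod_cubes\<^esub> (cube_class z) = cube_class (inverse z)"
proof -
  interpret group "mod_cubes :: 'a set monoid"
    unfolding mod_cubes_def by (rule normal.factorgroup_is_group[OF normal_nonzero_cubes])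
  show ?thesis
    using assms
    by (intro inv_equality) (auto simp: mult_mod_cubes one_mod_cubes carrier_mod_cubes)
qed

text \<open>
  Conjugation of cosets as sets agrees with conjugation of representatives, so membership in
  \<open>U_grp\<close> is a condition on a representative.
\<close>

lemma (in quadratic_field) conj_cube_class: "gal_conj \<iota> ` cube_class z = cube_class (z\<^sup>\<star>)"
proof -
  have "x \<in> gal_conj \<iota> ` cube_class z \<longleftrightarrow> x \<in> cube_class (z\<^sup>\<star>)" for x
  proof -
    have "x \<in> gal_conj \<iota> ` cube_class z \<longleftrightarrow> x\<^sup>\<star> \<in> cube_class z"
      by (metis conj_conj imageE imageI)
    also have "\<dots> \<longleftrightarrow> (\<exists>u. u \<noteq> 0 \<and> x = u\<^sup>\<star> ^ 3 * z\<^sup>\<star>)"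
      unfolding mem_cube_class by (metis conj.mult conj.power conj_conj)
    also have "\<dots> \<longleftrightarrow> x \<in> cube_class (z\<^sup>\<star>)"
      unfolding mem_cube_class by (metis conj.eq_zero_iff conj_conj)
    finally show ?thesis .
  qed
  then show ?thesis by blast
qed

context quadratic_field
begin

definition cube_norm :: "'K \<Rightarrow> bool" where
  "cube_norm z \<longleftrightarrow> z \<noteq> 0 \<and> (\<exists>u. z * z\<^sup>\<star> = u ^ 3)"

lemma U_grp_eq: "U_grp \<iota> = {cube_class z | z. cube_norm z}"
proof -
  have "cube_class z \<otimes>\<^bsub>mod_cubes\<^esub> (gal_conj \<iota> ` cube_class z) = \<one>\<^bsub>mod_cubes\<^esub>
    \<longleftrightarrow> (\<exists>u. z * z\<^sup>\<star> = u ^ 3)" if "z \<noteq> 0" for z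
  proof -
    have "cube_class 1 = cube_class (z * z\<^sup>\<star>) \<longleftrightarrow> (\<exists>u. u \<noteq> 0 \<and> z * z\<^sup>\<star> = u ^ 3)"
      by (simp add: cube_class_eq_iff)
    also have "\<dots> \<longleftrightarrow> (\<exists>u. z * z\<^sup>\<star> = u ^ 3)"
      using that by (metis conj.eq_zero_iff mult_eq_0_iff power_zero_numeral)
    finally show ?thesis
      using that by (simp add: conj_cube_class mult_mod_cubes one_mod_cubes eq_commute[of _ "cube_class 1"])
  qed
  then show ?thesis by (auto simp: U_grp_def carrier_mod_cubes cube_norm_def)
qed

lemma cube_norm_inverse: "cube_norm z \<Longrightarrow> cube_norm (inverse z)"
  unfolding cube_norm_def by (metis conj.inverse inverse_mult_distrib inverse_nonzero_iff_nonzero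
      mult.commute power_inverse)

lemma equiv_Z2_rel: "equiv (Im_star \<iota> \<times> U_grp \<iota>) (Z2_rel \<iota>)"
proof (rule equivI)
  have inv: "inv\<^bsub>mod_cubes\<^esub> \<alpha> \<in> U_grp \<iota> \<and> inv\<^bsub>mod_cubes\<^esub> (inv\<^bsub>mod_cubes\<^esub> \<alpha>) = \<alpha>"
    if \<alpha>: "\<alpha> \<in> U_grp \<iota>" for \<alpha>
  proof -
    obtain z where z: "\<alpha> = cube_class z" "cube_norm z" using \<alpha> by (auto simp: U_grp_eq)
    have "z \<noteq> 0" using z(2) by (simp add: cube_norm_def)
    with z cube_norm_inverse[OF z(2)] show ?thesis
      by (auto simp: U_grp_eq inv_mod_cubes)
  qed
  have Im: "- \<xi> \<in> Im_star \<iota>" if "\<xi> \<in> Im_star \<iota>" for \<xi>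
    using that by (simp add: Im_star_def)
  show "Z2_rel \<iota> \<subseteq> (Im_star \<iota> \<times> U_grp \<iota>) \<times> (Im_star \<iota> \<times> U_grp \<iota>)"
    using inv Im by (auto simp: Z2_rel_def)
  show "refl_on (Im_star \<iota> \<times> U_grp \<iota>) (Z2_rel \<iota>)"
    by (auto simp: refl_on_def Z2_rel_def)
  show "sym (Z2_rel \<iota>)"
    using inv Im by (auto simp: sym_def Z2_rel_def)
  show "trans (Z2_rel \<iota>)"
    using inv by (auto simp: trans_def Z2_rel_def)
qed

lemma Z2_class_eq_iff:
  assumes "\<xi> \<in> Im_star \<iota>" "cube_norm z" "\<xi>' \<in> Im_star \<iota>" "cube_norm z'"
  shows "Z2_class \<iota> \<xi> (cube_class z) = Z2_class \<iota> \<xi>' (cube_class z') \<longleftrightarrow>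
    (\<xi>' = \<xi> \<and> (\<exists>u. u \<noteq> 0 \<and> z' = u ^ 3 * z)) \<or> (\<xi>' = - \<xi> \<and> (\<exists>u. u \<noteq> 0 \<and> z' = u ^ 3 * inverse z))"
proof -
  have "Z2_class \<iota> \<xi> (cube_class z) = Z2_class \<iota> \<xi>' (cube_class z') \<longleftrightarrow>
    ((\<xi>, cube_class z), (\<xi>', cube_class z')) \<in> Z2_rel \<iota>"
    unfolding Z2_class_def using assms
    by (intro eq_equiv_class_iff[OF equiv_Z2_rel]) (auto simp: U_grp_eq)
  also have "\<dots> \<longleftrightarrow> (\<xi>' = \<xi> \<and> cube_class z = cube_class z') \<or>
      (\<xi>' = - \<xi> \<and> cube_class (inverse z) = cube_class z')"
  proof -
    have "z \<noteq> 0" "cube_class z \<in> U_grp \<iota>"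
      using assms(2) by (auto simp: cube_norm_def U_grp_eq)
    with assms(1) show ?thesis by (auto simp: Z2_rel_def inv_mod_cubes)
  qed
  finally show ?thesis using assms(2) by (simp add: cube_class_eq_iff cube_norm_def)
qed

lemma Im_times_U_eq:
  "Im_times_U \<iota> = {Z2_class \<iota> \<xi> (cube_class z) | \<xi> z. \<xi> \<in> Im_star \<iota> \<and> cube_norm z}"
  unfolding Im_times_U_def quotient_def U_grp_eq Z2_class_def by blast

lemma cube_norm_quotient: "l \<noteq> 0 \<Longrightarrow> cube_norm (l * inverse (l\<^sup>\<star>))"
  unfolding cube_norm_def by (auto simp: field_simps intro!: exI[of _ 1])

end


section \<open>Sums of two conjugate cubes\<close>

text \<open>
  The last four equations say that the cubic covariant of \<open>T + T'\<close> is \<open>w (T - T')\<close>, where \<open>w\<close> is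
  the symplectic pairing of the cubes \<open>T\<close> and \<open>T'\<close>. Together with \<open>T + T'\<close> and a nonzero \<open>w\<close> it determines
  both cubes, which gives uniqueness of the decomposition without any discussion of roots.
\<close>

lemma covariants_of_sum_of_cubes:
  fixes l :: "'a::field"
  assumes "a = l * p^3 + l' * p'^3" "b = l * p^2 * q + l' * p'^2 * q'"
    "c = l * p * q^2 + l' * p' * q'^2" "d = l * q^3 + l' * q'^3"
    and w: "w = l * l' * (p * q' - q * p') ^ 3"
  shows "a\<^sup>2 * d\<^sup>2 - 3 * b\<^sup>2 * c\<^sup>2 - 6 * a * b * c * d + 4 * b^3 * d + 4 * a * c^3 = w\<^sup>2"
    and "a^2 * d - 3 * a * b * c + 2 * b^3 = w * (l * p^3 - l' * p'^3)"
    and "a * b * d - 2 * a * c^2 + b^2 * c = w * (l * p^2 * q - l' * p'^2 * q')"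
    and "2 * b^2 * d - a * c * d - b * c^2 = w * (l * p * q^2 - l' * p' * q'^2)"
    and "3 * b * c * d - a * d^2 - 2 * c^3 = w * (l * q^3 - l' * q'^3)"
  unfolding assms by algebra+

context quadratic_field
begin

definition decomp :: "'k poly poly \<Rightarrow> 'K \<Rightarrow> 'K \<Rightarrow> 'K \<Rightarrow> bool" where
  "decomp P l p q \<longleftrightarrow> l \<noteq> 0 \<and>
     base_ext \<iota> P = cst l * lin p q ^ 3 + cst (l\<^sup>\<star>) * lin (p\<^sup>\<star>) (q\<^sup>\<star>) ^ 3"

definition bracket :: "'K \<Rightarrow> 'K \<Rightarrow> 'K" where
  "bracket p q = p * q\<^sup>\<star> - q * p\<^sup>\<star>"

text \<open>
  The value of the symplectic form on the two conjugate summands of a decomposition.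
\<close>

definition pairing :: "'K \<Rightarrow> 'K \<Rightarrow> 'K \<Rightarrow> 'K" where
  "pairing l p q = l * l\<^sup>\<star> * bracket p q ^ 3"

lemma conj_bracket: "(bracket p q)\<^sup>\<star> = - bracket p q"
  by (simp add: bracket_def mult.commute)

lemma conj_pairing: "(pairing l p q)\<^sup>\<star> = - pairing l p q"
  by (simp add: pairing_def conj_bracket mult.commute)

lemma bracket_conj: "bracket (p\<^sup>\<star>) (q\<^sup>\<star>) = - bracket p q"
  by (simp add: bracket_def mult.commute)

lemma bracket_scale: "bracket (c * p) (c * q) = c * c\<^sup>\<star> * bracket p q"
  by (simp add: bracket_def algebra_simps)

lemma decomp_coeffs:
  "decomp (cubic a b c d) l p q \<longleftrightarrow> l \<noteq> 0 \<and>
     \<iota> a = l * p^3 + l\<^sup>\<star> * p\<^sup>\<star>^3 \<and> \<iota> b = l * p^2 * q + l\<^sup>\<star> * p\<^sup>\<star>^2 * q\<^sup>\<star> \<and>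
     \<iota> c = l * p * q^2 + l\<^sup>\<star> * p\<^sup>\<star> * q\<^sup>\<star>^2 \<and> \<iota> d = l * q^3 + l\<^sup>\<star> * q\<^sup>\<star>^3"
  by (simp add: decomp_def scaled_cube cubic_add cubic_eq_iff)

lemma O_cubics_iff:
  "P \<in> O_cubics \<iota> \<longleftrightarrow> P \<in> binary_cubics \<and> (\<exists>t. t \<noteq> 0 \<and> t\<^sup>\<star> = - t \<and> t\<^sup>2 = \<iota> (Qn P))"
  by (simp add: O_cubics_def splitting_field_iff)

lemma Qn_decomp:
  assumes "P \<in> binary_cubics" "decomp P l p q"
  shows "\<iota> (Qn P) = (pairing l p q)\<^sup>2"
proof -
  obtain a b c d where P: "P = cubic a b c d" using assms(1) by (auto simp: binary_cubics_cubic)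
  have "\<iota> (Qn P) = (\<iota> a)\<^sup>2 * (\<iota> d)\<^sup>2 - 3 * (\<iota> b)\<^sup>2 * (\<iota> c)\<^sup>2 - 6 * \<iota> a * \<iota> b * \<iota> c * \<iota> d
     + 4 * \<iota> b^3 * \<iota> d + 4 * \<iota> a * \<iota> c^3"
    by (simp add: P Qn_cubic three)
  also have "\<dots> = (pairing l p q)\<^sup>2"
    using assms(2) unfolding P decomp_coeffs
    by (intro covariants_of_sum_of_cubes(1)) (auto simp: pairing_def bracket_def)
  finally show ?thesis .
qed

text \<open>
  The pairing is imaginary and its square is \<open>Qn\<close>, so it is the required square root.
\<close>

lemma O_cubics_decomp_iff:
  assumes "P \<in> binary_cubics" "decomp P l p q"
  shows "P \<in> O_cubics \<iota> \<longleftrightarrow> pairing l p q \<noteq> 0"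
proof
  show "pairing l p q \<noteq> 0" if "P \<in> O_cubics \<iota>"
    using that Qn_decomp[OF assms] unfolding O_cubics_iff by (metis power_zero_numeral power_eq_0_iff)
  show "P \<in> O_cubics \<iota>" if "pairing l p q \<noteq> 0"
    using that Qn_decomp[OF assms] assms conj_pairing unfolding O_cubics_iff by metis
qed

lemma decomp_conj: "decomp P l p q \<Longrightarrow> decomp P (l\<^sup>\<star>) (p\<^sup>\<star>) (q\<^sup>\<star>)"
  by (simp add: decomp_def add.commute)

lemma pairing_conj: "pairing (l\<^sup>\<star>) (p\<^sup>\<star>) (q\<^sup>\<star>) = - pairing l p q"
  by (simp add: pairing_def bracket_conj mult.commute)

lemma decomp_scale:
  assumes "decomp P (c ^ 3 * l) p q"
  shows "decomp P l (c * p) (c * q)"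
proof -
  have "cst (c ^ 3 * l) * lin p q ^ 3 = cst l * lin (c * p) (c * q) ^ 3" for c l p q :: 'K
    unfolding scaled_cube by (simp add: power3_eq_cube power2_eq_square algebra_simps)
  with assms show ?thesis by (simp add: decomp_def)
qed

text \<open>
  The sign of the pairing fixes the order of the two conjugate summands. With equal pairings both
  the sum and, by the cubic covariant, the difference of the summands agree.
\<close>

lemma summand_unique:
  assumes "P \<in> binary_cubics" "decomp P l p q" "decomp P l' p' q'"
    and "pairing l' p' q' = pairing l p q" "pairing l p q \<noteq> 0"
  shows "cst l * lin p q ^ 3 = cst l' * lin p' q' ^ 3"
proof -
  obtain a b c d where P: "P = cubic a b c d" using assms(1) by (auto simp: binary_cubics_cubic)
  have half: "s = t" if "s + s' = t + t'" "w * (s - s') = w * (t - t')" "w \<noteq> 0" for s s' t t' w :: 'K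
  proof -
    have "s - s' = t - t'" using that by simp
    with that(1) have "2 * s = 2 * t" by algebra
    then show ?thesis by simp
  qed
  have D: "\<iota> a = l * p^3 + l\<^sup>\<star> * p\<^sup>\<star>^3" "\<iota> b = l * p^2 * q + l\<^sup>\<star> * p\<^sup>\<star>^2 * q\<^sup>\<star>"
     "\<iota> c = l * p * q^2 + l\<^sup>\<star> * p\<^sup>\<star> * q\<^sup>\<star>^2" "\<iota> d = l * q^3 + l\<^sup>\<star> * q\<^sup>\<star>^3"
    "pairing l p q = l * l\<^sup>\<star> * (p * q\<^sup>\<star> - q * p\<^sup>\<star>) ^ 3"
    using assms(2) unfolding P decomp_coeffs by (auto simp: pairing_def bracket_def)
  have D': "\<iota> a = l' * p'^3 + l'\<^sup>\<star> * p'\<^sup>\<star>^3" "\<iota> b = l' * p'^2 * q' + l'\<^sup>\<star> * p'\<^sup>\<star>^2 * q'\<^sup>\<star>"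
     "\<iota> c = l' * p' * q'^2 + l'\<^sup>\<star> * p'\<^sup>\<star> * q'\<^sup>\<star>^2" "\<iota> d = l' * q'^3 + l'\<^sup>\<star> * q'\<^sup>\<star>^3"
    "pairing l p q = l' * l'\<^sup>\<star> * (p' * q'\<^sup>\<star> - q' * p'\<^sup>\<star>) ^ 3"
    using assms(3) unfolding assms(4)[symmetric] P decomp_coeffs
    by (auto simp: pairing_def bracket_def)
  note G = covariants_of_sum_of_cubes(2-5)[OF D] and G' = covariants_of_sum_of_cubes(2-5)[OF D']
  have "l * p^3 = l' * p'^3"
    by (rule half[OF _ _ assms(5)]) (use D(1) D'(1) G(1) G'(1) in simp_all)
  moreover have "l * p^2 * q = l' * p'^2 * q'"
    by (rule half[OF _ _ assms(5)]) (use D(2) D'(2) G(2) G'(2) in simp_all)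
  moreover have "l * p * q^2 = l' * p' * q'^2"
    by (rule half[OF _ _ assms(5)]) (use D(3) D'(3) G(3) G'(3) in simp_all)
  moreover have "l * q^3 = l' * q'^3"
    by (rule half[OF _ _ assms(5)]) (use D(4) D'(4) G(4) G'(4) in simp_all)
  ultimately show ?thesis by (simp add: scaled_cube)
qed

text \<open>
  Comparing one nonvanishing coefficient \<open>l p\<^sup>3\<close> or \<open>l q\<^sup>3\<close> shows that the scalars differ by a cube.
\<close>

lemma scaled_cube_eqE:
  assumes "cst l * lin p q ^ 3 = cst l' * lin p' q' ^ 3" "l \<noteq> (0::'K)" "l' \<noteq> 0" "p \<noteq> 0 \<or> q \<noteq> 0"
  obtains u where "u \<noteq> 0" "l = u ^ 3 * l'"
proof -
  have e: "l * p^3 = l' * p'^3" "l * q^3 = l' * q'^3"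
    using assms(1) by (simp_all add: scaled_cube cubic_eq_iff)
  have "\<exists>u. u \<noteq> 0 \<and> l = u ^ 3 * l'" if "x \<noteq> 0" "l * x ^ 3 = l' * y ^ 3" for x y
  proof (intro exI conjI)
    show "y / x \<noteq> 0" using that assms by auto
    show "l = (y / x) ^ 3 * l'" using that by (simp add: power_divide field_simps)
  qed
  with e assms(4) that show thesis by metis
qed


section \<open>Independence of the invariant from the decomposition\<close>

definition invariant :: "'K \<Rightarrow> 'K \<Rightarrow> 'K \<Rightarrow> ('K \<times> 'K set) set" where
  "invariant l p q = Z2_class \<iota> (pairing l p q) (cube_class (l * inverse (l\<^sup>\<star>)))"

lemma pairing_in_Im_star: "pairing l p q \<noteq> 0 \<Longrightarrow> pairing l p q \<in> Im_star \<iota>"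
  by (simp add: Im_star_def conj_pairing)

lemma invariant_eq_iff:
  assumes "pairing l p q \<noteq> 0" "pairing l' p' q' \<noteq> 0"
  shows "invariant l p q = invariant l' p' q' \<longleftrightarrow>
    (pairing l' p' q' = pairing l p q \<and>
       (\<exists>u. u \<noteq> 0 \<and> l' * inverse (l'\<^sup>\<star>) = u ^ 3 * (l * inverse (l\<^sup>\<star>)))) \<or>
    (pairing l' p' q' = - pairing l p q \<and>
       (\<exists>u. u \<noteq> 0 \<and> l' * inverse (l'\<^sup>\<star>) = u ^ 3 * (l\<^sup>\<star> * inverse l)))"
proof -
  have "l \<noteq> 0" "l' \<noteq> 0" using assms by (auto simp: pairing_def)
  then show ?thesis
    unfolding invariant_def using assms
    by (subst Z2_class_eq_iff) (auto simp: pairing_in_Im_star cube_norm_quotient mult.commute)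
qed

lemma invariant_conj:
  assumes "pairing l p q \<noteq> 0"
  shows "invariant (l\<^sup>\<star>) (p\<^sup>\<star>) (q\<^sup>\<star>) = invariant l p q"
proof -
  have "l \<noteq> 0" using assms by (auto simp: pairing_def)
  then show ?thesis
    using assms by (subst invariant_eq_iff) (auto simp: pairing_conj intro!: exI[of _ 1])
qed

text \<open>
  Two decompositions have pairings with the same square. If the pairings agree, so do the first
  summands, and the scalars differ by a cube; if they are opposite, the second decomposition
  is compared with the conjugate of the first one, which has the same invariant because of the
  quotient by the group of order two.
\<close>

lemma invariant_unique:
  assumes P: "P \<in> O_cubics \<iota>" and d: "decomp P l p q" and d': "decomp P l' p' q'"
  shows "invariant l p q = invariant l' p' q'"
proof -
  have cub: "P \<in> binary_cubics" using P by (simp add: O_cubics_def)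
  have nz: "pairing l p q \<noteq> 0" "pairing l' p' q' \<noteq> 0"
    using O_cubics_decomp_iff[OF cub] P d d' by blast+
  have same: "invariant l p q = invariant l' p' q'"
    if d: "decomp P l p q" and nz: "pairing l p q \<noteq> 0" and eq: "pairing l' p' q' = pairing l p q" for l p q
  proof -
    have nonzero: "p' \<noteq> 0 \<or> q' \<noteq> 0" "l \<noteq> 0" "l' \<noteq> 0"
      using nz eq by (auto simp: pairing_def bracket_def)
    have "cst l' * lin p' q' ^ 3 = cst l * lin p q ^ 3"
      using summand_unique[OF cub d' d] nz eq by simp
    then obtain u where u: "u \<noteq> 0" "l' = u ^ 3 * l"
      using scaled_cube_eqE nonzero by metis
    then have "l' * inverse (l'\<^sup>\<star>) = (u * inverse (u\<^sup>\<star>)) ^ 3 * (l * inverse (l\<^sup>\<star>))"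
      by (simp add: power_mult_distrib power_inverse)
    moreover have "u * inverse (u\<^sup>\<star>) \<noteq> 0" using u by simp
    ultimately show ?thesis
      using nz eq by (subst invariant_eq_iff) metis+
  qed
  have "(pairing l' p' q')\<^sup>2 = (pairing l p q)\<^sup>2"
    using Qn_decomp[OF cub] d d' by metis
  then consider "pairing l' p' q' = pairing l p q" | "pairing l' p' q' = - pairing l p q"
    by (auto simp: power2_eq_iff)
  then show ?thesis
  proof cases
    case 1
    then show ?thesis using same d nz by blast
  next
    case 2
    then have "invariant (l\<^sup>\<star>) (p\<^sup>\<star>) (q\<^sup>\<star>) = invariant l' p' q'"
      using same[OF decomp_conj[OF d]] nz by (simp add: pairing_conj)
    then show ?thesis using invariant_conj nz by simp
  qed
qed

lemma I_inv_eq: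
  assumes P: "P \<in> O_cubics \<iota>" and d: "decomp P l p q"
  shows "I_inv \<iota> P = invariant l p q"
proof -
  have omega: "omega (cst l * lin p q ^ 3) (cst (l\<^sup>\<star>) * lin (p\<^sup>\<star>) (q\<^sup>\<star>) ^ 3) = pairing l p q" for l p q
    by (simp add: omega_scaled_cubes pairing_def bracket_def)
  have "(\<exists>l \<alpha>. l \<noteq> 0 \<and> \<alpha> \<in> linear_forms \<and>
     (let T = cst l * \<alpha>^3; T' = cst (l\<^sup>\<star>) * (base_ext (gal_conj \<iota>) \<alpha>)^3 in
       base_ext \<iota> P = T + T' \<and>
       c = Z2_class \<iota> (omega T T') (cube_class (l * inverse (l\<^sup>\<star>)))))
    \<longleftrightarrow> (\<exists>l p q. decomp P l p q \<and> c = invariant l p q)" for c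
  proof
    assume "\<exists>l p q. decomp P l p q \<and> c = invariant l p q"
    then obtain l p q where "decomp P l p q" "c = invariant l p q" by blast
    then show "\<exists>l \<alpha>. l \<noteq> 0 \<and> \<alpha> \<in> linear_forms \<and>
     (let T = cst l * \<alpha>^3; T' = cst (l\<^sup>\<star>) * (base_ext (gal_conj \<iota>) \<alpha>)^3 in
       base_ext \<iota> P = T + T' \<and>
       c = Z2_class \<iota> (omega T T') (cube_class (l * inverse (l\<^sup>\<star>))))"
      by (intro exI[of _ l] exI[of _ "lin p q"])
        (auto simp: linear_forms_lin decomp_def invariant_def omega)
  qed (auto simp: linear_forms_lin Let_def decomp_def invariant_def omega, blast)
  then have "I_inv \<iota> P = (THE c. \<exists>l p q. decomp P l p q \<and> c = invariant l p q)"
    by (simp add: I_inv_def)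
  also have "\<dots> = invariant l p q"
    using d invariant_unique[OF P] by (intro the_equality) metis+
  finally show ?thesis .
qed


section \<open>Existence of decompositions\<close>

lemma decomp_exists:
  assumes "l \<noteq> 0"
  obtains P where "P \<in> binary_cubics" "decomp P l p q"
proof -
  have "\<exists>a. z + z\<^sup>\<star> = \<iota> a" for z
    by (rule conj_fixedE[of "z + z\<^sup>\<star>"]) (auto simp: add.commute)
  then obtain r where r: "z + z\<^sup>\<star> = \<iota> (r z)" for z by metis
  have "decomp (cubic (r (l * p^3)) (r (l * p^2 * q)) (r (l * p * q^2)) (r (l * q^3))) l p q"
    using assms by (simp add: decomp_coeffs flip: r)
  moreover have "cubic a b c d \<in> binary_cubics" for a b c d :: 'k
    by (auto simp: binary_cubics_cubic)
  ultimately show thesis using that by blast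
qed

lemma decomp_inject:
  assumes "decomp P l p q" "decomp P' l p q"
  shows "P = P'"
  using assms by (simp add: decomp_def flip: \<iota>.base_ext_inject)

text \<open>
  The Hessian of \<open>P\<close> is the quadratic form \<open>A x\<^sup>2 + B x y + C y\<^sup>2\<close> below, and its discriminant is \<open>Qn P\<close>.
  Over the extension it splits into two conjugate linear forms, and these are the linear forms
  of the decomposition. If \<open>A\<close> vanished, the discriminant would be a square in the base field; so
  the coefficient of \<open>x\<close> in the linear form is nonzero and can be made \<open>1\<close>.
\<close>

lemma O_cubics_normal_form:
  assumes "P \<in> O_cubics \<iota>"
  obtains l q where "decomp P l 1 q"
proof -
  obtain a b c d t where P: "P = cubic a b c d" and t: "t \<noteq> 0" "t\<^sup>\<star> = - t" "t\<^sup>2 = \<iota> (Qn P)"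
    using assms by (auto simp: O_cubics_iff binary_cubics_cubic)
  define A B C where "A = a * c - b\<^sup>2" and "B = a * d - b * c" and "C = b * d - c\<^sup>2"
  have Qn: "Qn P = B\<^sup>2 - 4 * A * C"
    unfolding P Qn_cubic[OF three] A_def B_def C_def by algebra
  have A: "A \<noteq> 0"
  proof
    assume "A = 0"
    then have "t\<^sup>2 = (\<iota> B)\<^sup>2" using t(3) by (simp add: Qn)
    then have "t = \<iota> B \<or> t = - \<iota> B" by (simp add: power2_eq_iff)
    then have "t\<^sup>\<star> = t" by auto
    then show False using t by simp
  qed
  define q where "q = (\<iota> B + t) / (2 * \<iota> A)"
  have qc: "q\<^sup>\<star> = (\<iota> B - t) / (2 * \<iota> A)" by (simp add: q_def t(2))
  have diff: "q - q\<^sup>\<star> = t / \<iota> A" using A by (simp add: q_def t(2) field_simps)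
  have sum: "\<iota> A * (q + q\<^sup>\<star>) = \<iota> B" using A by (simp add: q_def t(2) field_simps)
  have "\<iota> A * (q * q\<^sup>\<star>) = ((\<iota> B)\<^sup>2 - t\<^sup>2) / (4 * \<iota> A)"
    unfolding qc using A by (simp add: q_def field_simps power2_eq_square)
  also have "\<dots> = \<iota> C" using A by (simp add: t(3) Qn)
  finally have prod: "\<iota> A * (q * q\<^sup>\<star>) = \<iota> C" .
  \<comment> \<open>The coefficients satisfy the linear recurrence whose characteristic roots are \<open>q\<close> and its conjugate, so they are combinations of powers of the roots.\<close>
  have rec1: "\<iota> c = (q + q\<^sup>\<star>) * \<iota> b - q * q\<^sup>\<star> * \<iota> a"
  proof -
    have "c * A = B * b - C * a" unfolding A_def B_def C_def by algebra
    then have "\<iota> A * \<iota> c = \<iota> B * \<iota> b - \<iota> C * \<iota> a"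
      by (simp flip: \<iota>.mult \<iota>.diff add: mult.commute)
    also have "\<dots> = \<iota> A * ((q + q\<^sup>\<star>) * \<iota> b - q * q\<^sup>\<star> * \<iota> a)"
      by (simp add: sum[symmetric] prod[symmetric] algebra_simps)
    finally show ?thesis using A by simp
  qed
  have rec2: "\<iota> d = (q + q\<^sup>\<star>) * \<iota> c - q * q\<^sup>\<star> * \<iota> b"
  proof -
    have "d * A = B * c - C * b" unfolding A_def B_def C_def by algebra
    then have "\<iota> A * \<iota> d = \<iota> B * \<iota> c - \<iota> C * \<iota> b"
      by (simp flip: \<iota>.mult \<iota>.diff add: mult.commute)
    also have "\<dots> = \<iota> A * ((q + q\<^sup>\<star>) * \<iota> c - q * q\<^sup>\<star> * \<iota> b)"
      by (simp add: sum[symmetric] prod[symmetric] algebra_simps)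
    finally show ?thesis using A by simp
  qed
  have dq: "q - q\<^sup>\<star> \<noteq> 0" using diff t(1) A by simp
  define l where "l = (\<iota> b - q\<^sup>\<star> * \<iota> a) / (q - q\<^sup>\<star>)"
  have l: "l * (q - q\<^sup>\<star>) = \<iota> b - q\<^sup>\<star> * \<iota> a" using dq by (simp add: l_def)
  then have "(l * (q - q\<^sup>\<star>))\<^sup>\<star> = (\<iota> b - q\<^sup>\<star> * \<iota> a)\<^sup>\<star>" by (simp only:)
  then have lc: "l\<^sup>\<star> * (q\<^sup>\<star> - q) = \<iota> b - q * \<iota> a" by simp
  have "(l + l\<^sup>\<star>) * (q - q\<^sup>\<star>) = \<iota> a * (q - q\<^sup>\<star>)" using l lc by algebra
  then have la: "l + l\<^sup>\<star> = \<iota> a" using dq by simp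
  have "(l * q + l\<^sup>\<star> * q\<^sup>\<star>) * (q - q\<^sup>\<star>) = \<iota> b * (q - q\<^sup>\<star>)" using l lc by algebra
  then have lb: "l * q + l\<^sup>\<star> * q\<^sup>\<star> = \<iota> b" using dq by simp
  have lc2: "l * q\<^sup>2 + l\<^sup>\<star> * q\<^sup>\<star>\<^sup>2 = \<iota> c"
    unfolding rec1 la[symmetric] lb[symmetric] by algebra
  have ld: "l * q^3 + l\<^sup>\<star> * q\<^sup>\<star>^3 = \<iota> d"
    unfolding rec2 lc2[symmetric] lb[symmetric] by algebra
  have "l \<noteq> 0"
  proof
    assume "l = 0"
    then have "a = 0" "b = 0" using la lb by simp_all
    then show False using A by (simp add: A_def)
  qed
  then have "decomp P l 1 q"
    unfolding P decomp_coeffs using la lb lc2 ld by simp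
  then show thesis by (rule that)
qed


section \<open>The invariant separates orbits\<close>

text \<open>
  The coefficients of the transform of the linear form \<open>p x + q y\<close> under \<open>g\<close>.
\<close>

definition act_fst :: "'k ^ 2 ^ 2 \<Rightarrow> 'K \<Rightarrow> 'K \<Rightarrow> 'K" where
  "act_fst g p q = p * \<iota> (g$2$2) - q * \<iota> (g$2$1)"

definition act_snd :: "'k ^ 2 ^ 2 \<Rightarrow> 'K \<Rightarrow> 'K \<Rightarrow> 'K" where
  "act_snd g p q = q * \<iota> (g$1$1) - p * \<iota> (g$1$2)"

lemma decomp_act:
  assumes "det g = 1" "P \<in> binary_cubics" "decomp P l p q"
  shows "decomp (act g P) l (act_fst g p q) (act_snd g p q)"
proof -
  have "det (map_matrix \<iota> g) = \<iota> (det g)" by (simp add: map_matrix_def det_2)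
  then have g: "det (map_matrix \<iota> g) = 1" using assms by simp
  have "base_ext \<iota> (act g P) = act (map_matrix \<iota> g) (base_ext \<iota> P)"
    using assms by (intro \<iota>.base_ext_act)
  then show ?thesis
    using assms(3) by (simp add: decomp_def act_hom[OF g] act_fst_def act_snd_def)
      (simp add: map_matrix_def)
qed

lemma bracket_act:
  assumes "det g = 1"
  shows "bracket (act_fst g p q) (act_snd g p q) = bracket p q"
proof -
  have "bracket (act_fst g p q) (act_snd g p q) = bracket p q * \<iota> (det g)"
    by (simp add: bracket_def act_fst_def act_snd_def det_2 algebra_simps)
  with assms show ?thesis by simp
qed

lemma pairing_act:
  assumes "det g = 1"
  shows "pairing l (act_fst g p q) (act_snd g p q) = pairing l p q"
  by (simp add: pairing_def bracket_act assms)

text \<open>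
  Over the extension there is exactly one matrix that carries the form \<open>p x + q y\<close> and its conjugate to
  \<open>p' x + q' y\<close> and its conjugate. Cramer's rule writes its entries as quotients of imaginary elements, so
  they lie in the base field, and its determinant is the quotient of the two brackets.
\<close>

lemma SL2_transitive:
  assumes "bracket p q \<noteq> 0" "bracket p' q' = bracket p q"
  obtains g where "det g = 1" "act_fst g p q = p'" "act_snd g p q = q'"
proof -
  define D where "D = bracket p q"
  have D: "D \<noteq> 0" "D\<^sup>\<star> = - D" using assms by (simp_all add: D_def conj_bracket)
  have Dd: "p * q\<^sup>\<star> - q * p\<^sup>\<star> = D" "p' * q'\<^sup>\<star> - q' * p'\<^sup>\<star> = D"
    using assms by (simp_all add: D_def bracket_def)
  have rat: "\<exists>a. z / D = \<iota> a" if "z\<^sup>\<star> = - z" for z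
    by (rule conj_fixedE[of "z / D"]) (auto simp: that D)
  obtain g22 where g22: "(p' * q\<^sup>\<star> - q * p'\<^sup>\<star>) / D = \<iota> g22"
    using rat[of "p' * q\<^sup>\<star> - q * p'\<^sup>\<star>"] by (auto simp: mult.commute)
  obtain g21 where g21: "(p\<^sup>\<star> * p' - p * p'\<^sup>\<star>) / D = \<iota> g21"
    using rat[of "p\<^sup>\<star> * p' - p * p'\<^sup>\<star>"] by (auto simp: mult.commute)
  obtain g12 where g12: "(q * q'\<^sup>\<star> - q' * q\<^sup>\<star>) / D = \<iota> g12"
    using rat[of "q * q'\<^sup>\<star> - q' * q\<^sup>\<star>"] by (auto simp: mult.commute)
  obtain g11 where g11: "(p * q'\<^sup>\<star> - q' * p\<^sup>\<star>) / D = \<iota> g11"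
    using rat[of "p * q'\<^sup>\<star> - q' * p\<^sup>\<star>"] by (auto simp: mult.commute)
  let ?g = "vector [vector [g11, g12], vector [g21, g22]] :: 'k ^ 2 ^ 2"
  have e: "\<iota> g22 * D = p' * q\<^sup>\<star> - q * p'\<^sup>\<star>" "\<iota> g21 * D = p\<^sup>\<star> * p' - p * p'\<^sup>\<star>"
     "\<iota> g12 * D = q * q'\<^sup>\<star> - q' * q\<^sup>\<star>" "\<iota> g11 * D = p * q'\<^sup>\<star> - q' * p\<^sup>\<star>"
    using D by (simp_all flip: g11 g12 g21 g22)
  have fst: "p * \<iota> g22 - q * \<iota> g21 = p'"
  proof -
    have "(p * \<iota> g22 - q * \<iota> g21) * D = p' * D" using e Dd by algebra
    then show ?thesis using D by simp
  qed
  have snd: "q * \<iota> g11 - p * \<iota> g12 = q'"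
  proof -
    have "(q * \<iota> g11 - p * \<iota> g12) * D = q' * D" using e Dd by algebra
    then show ?thesis using D by simp
  qed
  have "\<iota> (det ?g) * D = D"
  proof -
    have "bracket (act_fst ?g p q) (act_snd ?g p q) = \<iota> (det ?g) * D"
      by (simp add: bracket_def act_fst_def act_snd_def det_2 Dd(1)[symmetric] algebra_simps)
    moreover have "act_fst ?g p q = p'" "act_snd ?g p q = q'"
      by (simp_all add: act_fst_def act_snd_def fst snd)
    ultimately show ?thesis using assms D_def by simp
  qed
  then have "\<iota> (det ?g) = \<iota> 1" using D by simp
  then have "det ?g = 1" by (simp only: \<iota>.eq_iff)
  then show thesis using that[of ?g] fst snd by (simp add: act_fst_def act_snd_def)
qed

text \<open>
  Since brackets are imaginary, equality of the pairings makes the norm of \<open>m = l' / l\<close> a cube \<open>s\<^sup>3\<close> with \<open>s\<close> in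
  the base field. The other hypothesis says that \<open>m\<close> divided by its conjugate is a cube \<open>u\<^sup>3\<close>. Multiplying,
  \<open>m\<^sup>2\<close> is a cube, hence so is \<open>m = m\<^sup>3 / m\<^sup>2\<close>, and it can be absorbed into the linear form.
  After that the two brackets have equal cubes; their quotient is a cube root of unity \<open>w\<close> in the base
  field, which is removed by a further rescaling that leaves the cube of the form unchanged.
\<close>

lemma SL2_conjugate:
  assumes P: "P \<in> binary_cubics" "decomp P l p q"
    and P': "decomp P' l' p' q'"
    and pairing: "pairing l' p' q' = pairing l p q" "pairing l p q \<noteq> 0"
    and u: "l' * inverse (l'\<^sup>\<star>) = u ^ 3 * (l * inverse (l\<^sup>\<star>))"
  obtains g where "det g = 1" "P' = act g P"
proof -
  have nz: "l \<noteq> 0" "l' \<noteq> 0" "bracket p q \<noteq> 0" "bracket p' q' \<noteq> 0"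
    using pairing by (auto simp: pairing_def)
  define s where "s = bracket p q / bracket p' q'"
  define m where "m = l' / l"
  have s: "s\<^sup>\<star> = s" "s \<noteq> 0" "m \<noteq> 0" using nz by (simp_all add: s_def m_def conj_bracket)
  have "m * m\<^sup>\<star> = s ^ 3"
    using pairing nz by (simp add: m_def s_def pairing_def field_simps)
  moreover have mu: "m = u ^ 3 * m\<^sup>\<star>"
    using u nz by (simp add: m_def field_simps)
  ultimately have m2: "m ^ 2 = (u * s) ^ 3"
    by (simp add: power2_eq_square power_mult_distrib) (metis mult.assoc mult.left_commute)
  define v where "v = m / (u * s)"
  have "u \<noteq> 0" using mu s(3) by auto
  have "v ^ 3 = m"
  proof -
    have "v ^ 3 = m ^ 3 / m ^ 2" by (simp add: v_def power_divide m2)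
    then show ?thesis using s(3) by (simp add: power3_eq_cube power2_eq_square)
  qed
  then have "l' = v ^ 3 * l" using nz by (simp add: m_def)
  then have d: "decomp P' l (v * p') (v * q')"
    using P' by (intro decomp_scale) simp
  have v0: "v \<noteq> 0" using \<open>v ^ 3 = m\<close> s(3) by auto
  \<comment> \<open>Scaling by \<open>w\<^sup>2\<close> multiplies the bracket by \<open>w\<^sup>4 = w\<close>.\<close>
  define w where "w = bracket p q / bracket (v * p') (v * q')"
  have br: "bracket (v * p') (v * q') \<noteq> 0" using v0 nz by (simp add: bracket_scale)
  have wc: "w\<^sup>\<star> = w" using br by (simp add: w_def conj_bracket)
  have "w ^ 3 = 1"
  proof -
    have "pairing l (v * p') (v * q') = pairing l p q"
      using pairing(1) unfolding \<open>l' = v ^ 3 * l\<close> pairing_def bracket_scale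
      by (simp add: power_mult_distrib mult_ac)
    then show ?thesis using nz br by (simp add: w_def pairing_def power_divide)
  qed
  have "decomp P' l (w ^ 2 * (v * p')) (w ^ 2 * (v * q'))"
  proof (rule decomp_scale)
    have "(w ^ 2) ^ 3 = (w ^ 3) ^ 2" by (metis power_commutes power_mult mult.commute)
    then show "decomp P' ((w ^ 2) ^ 3 * l) (v * p') (v * q')" using d \<open>w ^ 3 = 1\<close> by simp
  qed
  moreover have "bracket (w ^ 2 * (v * p')) (w ^ 2 * (v * q')) = bracket p q"
  proof -
    have "w ^ 2 * w ^ 2 = w" using \<open>w ^ 3 = 1\<close> by algebra
    then show ?thesis
      unfolding bracket_scale[of "w ^ 2"] using br by (simp add: wc) (simp add: w_def)
  qed
  then obtain g where g: "det g = 1" "act_fst g p q = w ^ 2 * (v * p')" "act_snd g p q = w ^ 2 * (v * q')"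
    using SL2_transitive nz(3) by metis
  ultimately have "P' = act g P"
    using decomp_act[OF g(1) P] by (metis decomp_inject)
  with g(1) show thesis by (rule that)
qed

lemma I_inv_act:
  assumes P: "P \<in> O_cubics \<iota>" and "act g P \<in> O_cubics \<iota>" "det g = 1"
  shows "I_inv \<iota> (act g P) = I_inv \<iota> P"
proof -
  obtain l q where d: "decomp P l 1 q" using O_cubics_normal_form P .
  have "decomp (act g P) l (act_fst g 1 q) (act_snd g 1 q)"
    using decomp_act d assms by (simp add: O_cubics_def)
  then show ?thesis
    using I_inv_eq d assms by (simp add: invariant_def pairing_act)
qed

text \<open>
  The alternative in the quotient by the group of order two is whether the decomposition of \<open>P\<close> or its
  conjugate is to be compared with that of \<open>P'\<close>.
\<close>

lemma I_inv_eq_imp_conjugate: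
  assumes P: "P \<in> O_cubics \<iota>" and P': "P' \<in> O_cubics \<iota>" and eq: "I_inv \<iota> P' = I_inv \<iota> P"
  obtains g where "det g = 1" "P' = act g P"
proof -
  obtain l q where d: "decomp P l 1 q" using O_cubics_normal_form P .
  obtain l' q' where d': "decomp P' l' 1 q'" using O_cubics_normal_form P' .
  have cub: "P \<in> binary_cubics" "P' \<in> binary_cubics" using P P' by (auto simp: O_cubics_def)
  have nz: "pairing l 1 q \<noteq> 0" "pairing l' 1 q' \<noteq> 0"
    using O_cubics_decomp_iff cub d d' P P' by blast+
  have "invariant l 1 q = invariant l' 1 q'" using eq I_inv_eq P P' d d' by simp
  then consider u where "pairing l' 1 q' = pairing l 1 q"
      "l' * inverse (l'\<^sup>\<star>) = u ^ 3 * (l * inverse (l\<^sup>\<star>))"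
    | u where "pairing l' 1 q' = - pairing l 1 q" "l' * inverse (l'\<^sup>\<star>) = u ^ 3 * (l\<^sup>\<star> * inverse l)"
    unfolding invariant_eq_iff[OF nz] by blast
  then show thesis
  proof cases
    case 1
    then show ?thesis using SL2_conjugate[OF cub(1) d d'] nz(1) that by metis
  next
    case 2
    then have "pairing l' 1 q' = pairing (l\<^sup>\<star>) (1\<^sup>\<star>) (q\<^sup>\<star>)" by (simp only: pairing_conj)
    then show ?thesis
      using SL2_conjugate[OF cub(1) decomp_conj[OF d] d', of u] 2 nz that
      by (metis conj_conj)
  qed
qed


section \<open>The values of the invariant\<close>

lemma I_inv_in_Im_times_U:
  assumes "P \<in> O_cubics \<iota>"
  shows "I_inv \<iota> P \<in> Im_times_U \<iota>"
proof -
  obtain l q where d: "decomp P l 1 q" using O_cubics_normal_form assms .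
  then have "l \<noteq> 0" by (simp add: decomp_def)
  moreover have "pairing l 1 q \<noteq> 0"
    using O_cubics_decomp_iff d assms by (metis O_cubics_iff)
  ultimately show ?thesis
    unfolding I_inv_eq[OF assms d] invariant_def Im_times_U_eq
    using pairing_in_Im_star cube_norm_quotient by blast
qed

text \<open>
  Let the norm of \<open>m\<close> be a cube. It is then a cube \<open>s\<^sup>3\<close> with \<open>s\<close> in the base field, so that the conjugate of \<open>m\<close>
  divided by \<open>m\<close> is \<open>s\<^sup>3 / m\<^sup>2\<close>, which is \<open>m\<close> up to a cube. A scalar \<open>l\<close> equal to the conjugate of \<open>m\<close> times
  an element of the base field therefore has the right class. That factor and the bracket, which can be any
  nonzero imaginary element, are adjusted to give the pairing \<open>\<xi>\<close>: the factor \<open>\<xi>\<^sup>2\<close> and the bracket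
  \<open>1 / (\<xi> s)\<close> do.
\<close>

lemma I_inv_surj:
  assumes "c \<in> Im_times_U \<iota>"
  obtains P where "P \<in> O_cubics \<iota>" "I_inv \<iota> P = c"
proof -
  obtain \<xi> m u where c: "c = Z2_class \<iota> \<xi> (cube_class m)" and \<xi>: "\<xi> \<in> Im_star \<iota>"
    and m: "m \<noteq> 0" "m * m\<^sup>\<star> = u ^ 3"
    using assms by (auto simp: Im_times_U_eq cube_norm_def)
  have x: "\<xi> \<noteq> 0" "\<xi>\<^sup>\<star> = - \<xi>" using \<xi> by (auto simp: Im_star_def)
  \<comment> \<open>The norm \<open>N = u\<^sup>3\<close> of \<open>m\<close> is fixed by conjugation, so \<open>N\<^sup>2\<close> is the cube of the norm of \<open>u\<close>, and \<open>N = N\<^sup>3 / N\<^sup>2\<close>.\<close>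
  define s where "s = m * m\<^sup>\<star> / (u * u\<^sup>\<star>)"
  have u0: "u \<noteq> 0" using m by auto
  have s0: "s \<noteq> 0" using m u0 by (simp add: s_def)
  have sc: "s\<^sup>\<star> = s" by (simp add: s_def mult.commute)
  have s3: "m * m\<^sup>\<star> = s ^ 3"
  proof -
    have "u ^ 3 = u\<^sup>\<star> ^ 3" by (metis conj.mult conj.power conj_conj m(2) mult.commute)
    then have "(u * u\<^sup>\<star>) ^ 3 = (m * m\<^sup>\<star>) ^ 2"
      by (simp add: power_mult_distrib[of u] m(2) power2_eq_square)
    then have "s ^ 3 = (m * m\<^sup>\<star>) ^ 3 / (m * m\<^sup>\<star>) ^ 2" by (simp add: s_def power_divide)
    also have "\<dots> = m * m\<^sup>\<star>" using m(1) by (simp add: power3_eq_cube power2_eq_square)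
    finally show ?thesis ..
  qed
  define l where "l = \<xi>\<^sup>2 * m\<^sup>\<star>"
  define q where "q = - (1 / (2 * \<xi> * s))"
  have l0: "l \<noteq> 0" using x m by (simp add: l_def)
  obtain P where P: "P \<in> binary_cubics" "decomp P l 1 q" using decomp_exists[OF l0] .
  have bracket: "bracket 1 q = 1 / (\<xi> * s)"
    using x sc s0 by (simp add: bracket_def q_def field_simps)
  have norm: "l * l\<^sup>\<star> = \<xi> ^ 4 * s ^ 3"
    by (simp add: l_def x s3[symmetric] power2_eq_square power4_eq_xxxx)
  have pr: "pairing l 1 q = \<xi>"
    unfolding pairing_def bracket norm using x s0
    by (simp add: power_divide power_mult_distrib power4_eq_xxxx power3_eq_cube)
  then have PO: "P \<in> O_cubics \<iota>" using O_cubics_decomp_iff[OF P] x by simp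
  have "l * inverse (l\<^sup>\<star>) = (s / m) ^ 3 * m"
  proof -
    have "l * inverse (l\<^sup>\<star>) = m\<^sup>\<star> / m" using x m by (simp add: l_def field_simps)
    also have "\<dots> = s ^ 3 / m ^ 2" using m(1) by (simp flip: s3 add: power2_eq_square)
    also have "\<dots> = (s / m) ^ 3 * m" using m(1)
      by (simp add: power_divide power2_eq_square power3_eq_cube)
    finally show ?thesis .
  qed
  moreover have "s / m \<noteq> 0" using s0 m by simp
  ultimately have "cube_class m = cube_class (l * inverse (l\<^sup>\<star>))"
    unfolding cube_class_eq_iff[OF m(1)] by blast
  then have "I_inv \<iota> P = c"
    unfolding I_inv_eq[OF PO P(2)] by (simp add: invariant_def pr c)
  with PO show thesis by (rule that)
qed


section \<open>Isotropy groups\<close>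

text \<open>
  An element that fixes \<open>P\<close> preserves the pairing, so it cannot interchange the two conjugate summands and
  fixes each of them. It therefore multiplies the linear form by a cube root of unity \<open>\<zeta>\<close>, its conjugate
  by the conjugate of \<open>\<zeta>\<close>, and determinant one means that \<open>\<zeta>\<close> has norm one. The isomorphism sends the
  element to the diagonal matrix of these eigenvalues.
\<close>

lemma stabilizer_iso:
  assumes P: "P \<in> O_cubics \<iota>"
  shows "SL2\<lparr>carrier := stabilizer SL2 act P\<rparr> \<cong> unitary_cube_roots_grp \<iota>"
proof -
  obtain l q where d: "decomp P l 1 q" using O_cubics_normal_form P .
  have cub: "P \<in> binary_cubics" using P by (auto simp: O_cubics_def)
  have nz: "pairing l 1 q \<noteq> 0" using O_cubics_decomp_iff cub d P by blast
  then have l0: "l \<noteq> 0" and br: "bracket 1 q \<noteq> 0" by (auto simp: pairing_def)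
  then have q: "q\<^sup>\<star> \<noteq> q" by (auto simp: bracket_def)
  define z where "z g = act_fst g 1 q" for g
  define diag :: "'K \<Rightarrow> 'K ^ 2 ^ 2" where "diag \<zeta> = vector [vector [\<zeta>, 0], vector [0, \<zeta>\<^sup>\<star>]]" for \<zeta>
  have diag_eq: "diag \<zeta> = diag \<eta> \<longleftrightarrow> \<zeta> = \<eta>" for \<zeta> \<eta>
    by (auto simp: diag_def vec_eq_iff forall_2)
  have diag_mult: "diag \<zeta> ** diag \<eta> = diag (\<zeta> * \<eta>)" for \<zeta> \<eta>
    by (simp add: diag_def vec_eq_iff forall_2 matrix_matrix_mult_def sum_2)
  have det_diag: "det (diag \<zeta>) = \<zeta> * \<zeta>\<^sup>\<star>" for \<zeta>
    by (simp add: diag_def det_2)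
  have stab: "det g = 1 \<and> act g P = P \<longleftrightarrow>
      det g = 1 \<and> act_snd g 1 q = q * z g \<and> z g ^ 3 = 1 \<and> z g * (z g)\<^sup>\<star> = 1" for g
  proof (intro iffI conjI; elim conjE)
    assume g: "det g = 1" and fixed: "act g P = P"
    have d': "decomp P l (z g) (act_snd g 1 q)"
      using decomp_act[OF g cub d] by (simp add: fixed z_def)
    have "cst l * lin (z g) (act_snd g 1 q) ^ 3 = cst l * lin 1 q ^ 3"
      using summand_unique[OF cub d d'] nz pairing_act[OF g] unfolding z_def by metis
    then have e: "z g ^ 3 = 1" "z g ^ 2 * act_snd g 1 q = q"
      using l0 by (simp_all add: scaled_cube cubic_eq_iff)
    then show "z g ^ 3 = 1" by simp
    from e show snd: "act_snd g 1 q = q * z g" by algebra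
    have "bracket (z g) (z g * q) = bracket 1 q"
      using bracket_act[OF g, of 1 q] by (simp add: z_def[symmetric] snd mult.commute)
    then show "z g * (z g)\<^sup>\<star> = 1"
      using br bracket_scale[of "z g" 1 q] by simp
  next
    assume g: "det g = 1" and snd: "act_snd g 1 q = q * z g" and z3: "z g ^ 3 = 1"
    have "decomp (act g P) l (z g) (q * z g)"
      using decomp_act[OF g cub d] snd by (simp add: z_def)
    moreover have "decomp P (z g ^ 3 * l) 1 q" using d z3 by simp
    then have "decomp P l (z g) (q * z g)" using decomp_scale[of P "z g" l 1 q] by (simp add: mult.commute)
    ultimately show "act g P = P" by (rule decomp_inject)
  qed auto
  have S: "stabilizer SL2 act P = {g. det g = 1 \<and> act g P = P}"
    by (auto simp: stabilizer_def SL2_def)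
  have U: "carrier (unitary_cube_roots_grp \<iota>) = diag ` {\<zeta>. \<zeta> ^ 3 = 1 \<and> \<zeta> * \<zeta>\<^sup>\<star> = 1}"
    by (auto simp: unitary_cube_roots_grp_def SL2_def diag_def[symmetric] det_diag)
  have mult_eq: "g \<otimes>\<^bsub>SL2\<^esub> h = g ** h"
    "A \<otimes>\<^bsub>unitary_cube_roots_grp \<iota>\<^esub> B = A ** B" for g h :: "'k ^ 2 ^ 2" and A B
    by (simp_all add: SL2_def unitary_cube_roots_grp_def)
  have mult: "z (g ** h) = z g * z h" if "det h = 1 \<and> act h P = P" for g h
  proof -
    have h: "act_snd h 1 q = q * z h" using that stab by blast
    have "z (g ** h) = \<iota> (g$2$2) * z h - \<iota> (g$2$1) * act_snd h 1 q"
      by (simp add: z_def act_fst_def act_snd_def matrix_matrix_mult_def sum_2 algebra_simps)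
    then show ?thesis by (simp add: h z_def[of g] act_fst_def algebra_simps)
  qed
  \<comment> \<open>As \<open>q\<close> is not in the base field, \<open>1\<close> and \<open>q\<close> are linearly independent over it.\<close>
  have indep: "a = a' \<and> b = b'" if "\<iota> a - q * \<iota> b = \<iota> a' - q * \<iota> b'" for a b a' b'
  proof -
    have "\<iota> a - q\<^sup>\<star> * \<iota> b = \<iota> a' - q\<^sup>\<star> * \<iota> b'"
      using that by (metis conj.diff conj.mult conj_base)
    with that have "(q\<^sup>\<star> - q) * (\<iota> b - \<iota> b') = 0" by algebra
    then have "b = b'" using q by simp
    then show ?thesis using that by simp
  qed
  have "(\<lambda>g. diag (z g)) \<in> iso (SL2\<lparr>carrier := stabilizer SL2 act P\<rparr>) (unitary_cube_roots_grp \<iota>)"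
    unfolding iso_iff
  proof (intro conjI)
    show "(\<lambda>g. diag (z g)) \<in> hom (SL2\<lparr>carrier := stabilizer SL2 act P\<rparr>) (unitary_cube_roots_grp \<iota>)"
      unfolding hom_def U using stab mult
      by (auto simp: S diag_mult mult_eq)
    show "inj_on (\<lambda>g. diag (z g)) (carrier (SL2\<lparr>carrier := stabilizer SL2 act P\<rparr>))"
    proof (rule inj_onI)
      fix g h assume "g \<in> carrier (SL2\<lparr>carrier := stabilizer SL2 act P\<rparr>)"
        "h \<in> carrier (SL2\<lparr>carrier := stabilizer SL2 act P\<rparr>)" and "diag (z g) = diag (z h)"
      then have e: "z g = z h" "act_snd g 1 q = act_snd h 1 q"
        using stab by (auto simp: S diag_eq)
      have "g$2$2 = h$2$2 \<and> g$2$1 = h$2$1"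
        using e(1) by (intro indep) (simp add: z_def act_fst_def)
      moreover have "g$1$2 = h$1$2 \<and> g$1$1 = h$1$1"
        using e(2) by (intro indep) (simp add: act_snd_def algebra_simps)
      ultimately show "g = h" by (simp add: vec_eq_iff forall_2)
    qed
    show "(\<lambda>g. diag (z g)) ` carrier (SL2\<lparr>carrier := stabilizer SL2 act P\<rparr>) = carrier (unitary_cube_roots_grp \<iota>)"
    proof
      show "(\<lambda>g. diag (z g)) ` carrier (SL2\<lparr>carrier := stabilizer SL2 act P\<rparr>) \<subseteq> carrier (unitary_cube_roots_grp \<iota>)"
        unfolding U using stab by (auto simp: S)
      show "carrier (unitary_cube_roots_grp \<iota>) \<subseteq> (\<lambda>g. diag (z g)) ` carrier (SL2\<lparr>carrier := stabilizer SL2 act P\<rparr>)"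
      proof
        fix A assume "A \<in> carrier (unitary_cube_roots_grp \<iota>)"
        then obtain \<zeta> where \<zeta>: "A = diag \<zeta>" "\<zeta> ^ 3 = 1" "\<zeta> * \<zeta>\<^sup>\<star> = 1" unfolding U by blast
        have "bracket \<zeta> (q * \<zeta>) = bracket 1 q"
          using bracket_scale[of \<zeta> 1 q] \<zeta>(3) by (simp add: mult.commute)
        then obtain g where g: "det g = 1" "act_fst g 1 q = \<zeta>" "act_snd g 1 q = q * \<zeta>"
          using SL2_transitive[OF br] by metis
        then have "z g = \<zeta>" by (simp add: z_def)
        then have "act g P = P" using stab g \<zeta> by blast
        with g(1) \<open>z g = \<zeta>\<close> show "A \<in> (\<lambda>g. diag (z g)) ` carrier (SL2\<lparr>carrier := stabilizer SL2 act P\<rparr>)"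
          by (auto simp: S \<zeta>(1))
      qed
    qed
  qed
  then show ?thesis by (rule is_isoI)
qed


section \<open>The orbit space\<close>

lemma orbit_eq_iff:
  assumes P: "P \<in> binary_cubics" "P' \<in> binary_cubics"
  shows "orbit SL2 act P' = orbit SL2 act P \<longleftrightarrow> (\<exists>g. det g = 1 \<and> P' = act g P)"
proof
  assume eq: "orbit SL2 act P' = orbit SL2 act P"
  have "act (mat 1) P' \<in> orbit SL2 act P'" by (auto simp: orbit_def SL2_def)
  then have "P' \<in> orbit SL2 act P" using P by (simp add: act_one eq)
  then show "\<exists>g. det g = 1 \<and> P' = act g P" by (auto simp: orbit_def SL2_def)
next
  assume "\<exists>g. det g = 1 \<and> P' = act g P"
  then obtain g where g: "det g = 1" "P' = act g P" by blast
  let ?i = "matrix_inv g"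
  have "invertible g" using g(1) by (simp add: invertible_det_nz)
  then have i: "g ** ?i = mat 1" "?i ** g = mat 1"
    unfolding invertible_def matrix_inv_def by (metis (mono_tags, lifting) someI_ex)+
  have di: "det ?i = 1" using arg_cong[OF i(1), of det] g(1) by (simp add: det_mul)
  have "\<exists>h'. det h' = 1 \<and> act h P' = act h' P" if "det h = 1" for h
    using that g by (intro exI[of _ "h ** g"]) (simp add: det_mul act_mult P)
  moreover have "\<exists>h'. det h' = 1 \<and> act h P = act h' P'" if "det h = 1" for h
  proof (intro exI conjI)
    have dhi: "det (h ** ?i) = 1" using that di by (simp add: det_mul)
    then show "det (h ** ?i) = 1" .
    have "act (h ** ?i) P' = act (h ** ?i ** g) P"
      using dhi g P by (simp add: act_mult)
    also have "h ** ?i ** g = h" by (simp add: i flip: matrix_mul_assoc)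
    finally show "act h P = act (h ** ?i) P'" ..
  qed
  ultimately show "orbit SL2 act P' = orbit SL2 act P"
    by (auto simp: orbit_def SL2_def)
qed

lemma orbit_eq_iff_I_inv:
  assumes "P \<in> O_cubics \<iota>" "P' \<in> O_cubics \<iota>"
  shows "orbit SL2 act P' = orbit SL2 act P \<longleftrightarrow> I_inv \<iota> P' = I_inv \<iota> P"
proof -
  have "P \<in> binary_cubics" "P' \<in> binary_cubics" using assms by (auto simp: O_cubics_def)
  then have "orbit SL2 act P' = orbit SL2 act P \<longleftrightarrow> (\<exists>g. det g = 1 \<and> P' = act g P)"
    by (rule orbit_eq_iff)
  also have "\<dots> \<longleftrightarrow> I_inv \<iota> P' = I_inv \<iota> P"
    using I_inv_act[OF assms(1)] I_inv_eq_imp_conjugate[OF assms] assms(2) by blast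
  finally show ?thesis .
qed

lemma orbits_bij:
  "\<exists>F. (\<forall>P\<in>O_cubics \<iota>. F (orbit SL2 act P) = I_inv \<iota> P) \<and>
     bij_betw F (orbits SL2 (O_cubics \<iota>) act) (Im_times_U \<iota>)"
proof (intro exI conjI)
  define F where "F o' = I_inv \<iota> (SOME P. P \<in> O_cubics \<iota> \<and> orbit SL2 act P = o')" for o'
  show F: "\<forall>P\<in>O_cubics \<iota>. F (orbit SL2 act P) = I_inv \<iota> P"
  proof
    fix P assume P: "P \<in> O_cubics \<iota>"
    define P' where "P' = (SOME P'. P' \<in> O_cubics \<iota> \<and> orbit SL2 act P' = orbit SL2 act P)"
    have "P' \<in> O_cubics \<iota> \<and> orbit SL2 act P' = orbit SL2 act P"
      unfolding P'_def by (rule someI[of _ P]) (simp add: P)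
    then show "F (orbit SL2 act P) = I_inv \<iota> P"
      using orbit_eq_iff_I_inv[OF P, of P'] by (simp add: F_def P'_def[symmetric])
  qed
  show "bij_betw F (orbits SL2 (O_cubics \<iota>) act) (Im_times_U \<iota>)"
    unfolding bij_betw_def
  proof
    show "inj_on F (orbits SL2 (O_cubics \<iota>) act)"
    proof (rule inj_onI)
      fix A B assume "A \<in> orbits SL2 (O_cubics \<iota>) act" "B \<in> orbits SL2 (O_cubics \<iota>) act" "F A = F B"
      then obtain P P' where P: "P \<in> O_cubics \<iota>" "P' \<in> O_cubics \<iota>"
        and eq: "A = orbit SL2 act P" "B = orbit SL2 act P'" by (auto simp: orbits_def)
      with \<open>F A = F B\<close> F have "I_inv \<iota> P = I_inv \<iota> P'" by simp
      then show "A = B" unfolding eq using orbit_eq_iff_I_inv P by blast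
    qed
    have "F ` orbits SL2 (O_cubics \<iota>) act = I_inv \<iota> ` O_cubics \<iota>"
      using F by (auto simp: orbits_def image_iff)
    also have "\<dots> = Im_times_U \<iota>"
      using I_inv_in_Im_times_U I_inv_surj by (metis (no_types, lifting) image_eqI image_subsetI subsetI subset_antisym)
    finally show "F ` orbits SL2 (O_cubics \<iota>) act = Im_times_U \<iota>" .
  qed
qed

end


section \<open>The classification\<close>

theorem theorem3p43:
  fixes \<iota> :: "'k::field \<Rightarrow> 'K::field"
  assumes "CHAR('k) \<noteq> 2" and "CHAR('k) \<noteq> 3"
    and "quadratic_extension \<iota>"
  shows "(\<forall>P\<in>O_cubics \<iota>. \<forall>P'\<in>O_cubics \<iota>.
            orbit SL2 act P' = orbit SL2 act P \<longleftrightarrow> I_inv \<iota> P' = I_inv \<iota> P) \<and>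
         (\<exists>F. (\<forall>P\<in>O_cubics \<iota>. F (orbit SL2 act P) = I_inv \<iota> P) \<and>
            bij_betw F (orbits SL2 (O_cubics \<iota>) act) (Im_times_U \<iota>)) \<and>
         (\<forall>P\<in>O_cubics \<iota>.
            SL2\<lparr>carrier := stabilizer SL2 act P\<rparr> \<cong> unitary_cube_roots_grp \<iota>)"
proof -
  interpret quadratic_field \<iota>
    using of_nat_prime_neq_zero[OF assms(1)] of_nat_prime_neq_zero[OF assms(2)] assms(3)
    by unfold_locales auto
  show ?thesis
    using orbit_eq_iff_I_inv orbits_bij stabilizer_iso by blast
qed

end
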